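(* Let $A$ be a unital algebra over a commutative ring $\mathbb{K}$, and let $\Delta,\Delta'\in A$ be well-tempered elements with homotopes $B=\widehat{A}_\Delta$ and $B'=\widehat{A}_{\Delta'}$. Suppose there exist elements $c,d,u,v,h_1,h_2\in A$ with $$c\Delta=\Delta' d,\qquad u\Delta'=\Delta v$$ and satisfying $$cu=1+\Delta'h_1,\quad dv=1+h_1\Delta',\quad uc=1+\Delta h_2,\quad vd=1+h_2\Delta .$$ Then the categories $B\text{-mod}$ and $B'\text{-mod}$ are equivalent.
   Context: Algebras over $\mathbb{K}$ are associative and assumed to be free as $\mathbb{K}$-modules. $R\text{-mod}$ is the category of left $R$-modules. All products in the displayed equations are taken in $A$. Homotope: for $\Delta\in A$, $B^+=A_\Delta$ is the algebra with underlying module $A$ and multiplication $a\cdot_\Delta b=a\Delta b$; $B=\widehat{A}_\Delta=\mathbb{K}\cdot 1\oplus B^+$ is obtained by adjoining a unit, so $B^+$ is a two-sided ideal of $B$. Well-tempered: $\Delta\in A$ is well-tempered if the multiplication map $B^+\otimes_{\mathbb{K}}B^+\to B^+$ is surjective (equivalently $A\Delta A=A$, the two-sided ideal generated by $\Delta$ being all of $A$) and $B^+$ is projective both as a left and as a right $B$-module. *)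

theory Defs
  imports "HOL-Algebra.Module" "HOL-Algebra.Ideal"
begin

section \<open>Categories and equivalences\<close>

record ('o, 'm) cat =
  Obj :: "'o set"
  Hom :: "'o \<Rightarrow> 'o \<Rightarrow> 'm set"
  Id :: "'o \<Rightarrow> 'm"
  Comp :: "'o \<Rightarrow> 'o \<Rightarrow> 'o \<Rightarrow> 'm \<Rightarrow> 'm \<Rightarrow> 'm"

text \<open>\<open>Comp C X Y Z g f\<close> is the composite of \<open>f : X \<rightarrow> Y\<close> followed by \<open>g : Y \<rightarrow> Z\<close>.
  Hom-sets of different pairs of objects need not be disjoint.\<close>

locale category =
  fixes C :: "('o, 'm) cat"
  assumes Id_closed: "X \<in> Obj C \<Longrightarrow> Id C X \<in> Hom C X X"
    and Comp_closed: "\<lbrakk>X \<in> Obj C; Y \<in> Obj C; Z \<in> Obj C; f \<in> Hom C X Y; g \<in> Hom C Y Z\<rbrakk>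
      \<Longrightarrow> Comp C X Y Z g f \<in> Hom C X Z"
    and Comp_Id_right: "\<lbrakk>X \<in> Obj C; Y \<in> Obj C; f \<in> Hom C X Y\<rbrakk> \<Longrightarrow> Comp C X X Y f (Id C X) = f"
    and Comp_Id_left: "\<lbrakk>X \<in> Obj C; Y \<in> Obj C; f \<in> Hom C X Y\<rbrakk> \<Longrightarrow> Comp C X Y Y (Id C Y) f = f"
    and Comp_assoc: "\<lbrakk>W \<in> Obj C; X \<in> Obj C; Y \<in> Obj C; Z \<in> Obj C;
        f \<in> Hom C W X; g \<in> Hom C X Y; h \<in> Hom C Y Z\<rbrakk>
      \<Longrightarrow> Comp C W X Z (Comp C X Y Z h g) f = Comp C W Y Z h (Comp C W X Y g f)"

record ('o, 'm, 'p, 'n) fctr =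
  on_obj :: "'o \<Rightarrow> 'p"
  on_hom :: "'o \<Rightarrow> 'o \<Rightarrow> 'm \<Rightarrow> 'n"

definition is_functor ::
  "('o, 'm) cat \<Rightarrow> ('p, 'n) cat \<Rightarrow> ('o, 'm, 'p, 'n) fctr \<Rightarrow> bool" where
  "is_functor C D F \<longleftrightarrow>
    (\<forall>X\<in>Obj C. on_obj F X \<in> Obj D) \<and>
    (\<forall>X\<in>Obj C. \<forall>Y\<in>Obj C. \<forall>f\<in>Hom C X Y. on_hom F X Y f \<in> Hom D (on_obj F X) (on_obj F Y)) \<and>
    (\<forall>X\<in>Obj C. on_hom F X X (Id C X) = Id D (on_obj F X)) \<and>
    (\<forall>X\<in>Obj C. \<forall>Y\<in>Obj C. \<forall>Z\<in>Obj C. \<forall>f\<in>Hom C X Y. \<forall>g\<in>Hom C Y Z.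
      on_hom F X Z (Comp C X Y Z g f) =
        Comp D (on_obj F X) (on_obj F Y) (on_obj F Z) (on_hom F Y Z g) (on_hom F X Y f))"

definition id_functor :: "('o, 'm, 'o, 'm) fctr" where
  "id_functor = \<lparr>on_obj = (\<lambda>X. X), on_hom = (\<lambda>X Y f. f)\<rparr>"

definition comp_functor ::
  "('p, 'n, 'q, 'l) fctr \<Rightarrow> ('o, 'm, 'p, 'n) fctr \<Rightarrow> ('o, 'm, 'q, 'l) fctr" where
  "comp_functor G F = \<lparr>on_obj = (\<lambda>X. on_obj G (on_obj F X)),
     on_hom = (\<lambda>X Y f. on_hom G (on_obj F X) (on_obj F Y) (on_hom F X Y f))\<rparr>"

definition is_iso :: "('o, 'm) cat \<Rightarrow> 'o \<Rightarrow> 'o \<Rightarrow> 'm \<Rightarrow> bool" where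
  "is_iso C X Y f \<longleftrightarrow> f \<in> Hom C X Y \<and>
    (\<exists>g\<in>Hom C Y X. Comp C X Y X g f = Id C X \<and> Comp C Y X Y f g = Id C Y)"

definition naturally_isomorphic ::
  "('o, 'm) cat \<Rightarrow> ('p, 'n) cat \<Rightarrow> ('o, 'm, 'p, 'n) fctr \<Rightarrow> ('o, 'm, 'p, 'n) fctr \<Rightarrow> bool" where
  "naturally_isomorphic C D F G \<longleftrightarrow>
    (\<exists>\<eta>. (\<forall>X\<in>Obj C. is_iso D (on_obj F X) (on_obj G X) (\<eta> X)) \<and>
      (\<forall>X\<in>Obj C. \<forall>Y\<in>Obj C. \<forall>f\<in>Hom C X Y.
        Comp D (on_obj F X) (on_obj F Y) (on_obj G Y) (\<eta> Y) (on_hom F X Y f) =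
        Comp D (on_obj F X) (on_obj G X) (on_obj G Y) (on_hom G X Y f) (\<eta> X)))"

definition equivalent_categories :: "('o, 'm) cat \<Rightarrow> ('p, 'n) cat \<Rightarrow> bool" where
  "equivalent_categories C D \<longleftrightarrow>
    (\<exists>F G. is_functor C D F \<and> is_functor D C G \<and>
      naturally_isomorphic C C (comp_functor G F) id_functor \<and>
      naturally_isomorphic D D (comp_functor F G) id_functor)"


section \<open>Left modules over rings\<close>

text \<open>The library locale \<^locale>\<open>module\<close> without commutativity of the ring. The fields \<open>mult\<close> and
  \<open>one\<close> of the record \<open>M\<close> are irrelevant for its module structure.\<close>

locale left_module = R?: ring R + M?: abelian_group M for R (structure) and M (structure) +
  assumes smult_closed [simp, intro]:
      "\<lbrakk>a \<in> carrier R; x \<in> carrier M\<rbrakk> \<Longrightarrow> a \<odot>\<^bsub>M\<^esub> x \<in> carrier M"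
    and smult_l_distr:
      "\<lbrakk>a \<in> carrier R; b \<in> carrier R; x \<in> carrier M\<rbrakk> \<Longrightarrow>
      (a \<oplus>\<^bsub>R\<^esub> b) \<odot>\<^bsub>M\<^esub> x = a \<odot>\<^bsub>M\<^esub> x \<oplus>\<^bsub>M\<^esub> b \<odot>\<^bsub>M\<^esub> x"
    and smult_r_distr:
      "\<lbrakk>a \<in> carrier R; x \<in> carrier M; y \<in> carrier M\<rbrakk> \<Longrightarrow>
      a \<odot>\<^bsub>M\<^esub> (x \<oplus>\<^bsub>M\<^esub> y) = a \<odot>\<^bsub>M\<^esub> x \<oplus>\<^bsub>M\<^esub> a \<odot>\<^bsub>M\<^esub> y"
    and smult_assoc1:
      "\<lbrakk>a \<in> carrier R; b \<in> carrier R; x \<in> carrier M\<rbrakk> \<Longrightarrow>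
      (a \<otimes>\<^bsub>R\<^esub> b) \<odot>\<^bsub>M\<^esub> x = a \<odot>\<^bsub>M\<^esub> (b \<odot>\<^bsub>M\<^esub> x)"
    and smult_one [simp]:
      "x \<in> carrier M \<Longrightarrow> \<one>\<^bsub>R\<^esub> \<odot>\<^bsub>M\<^esub> x = x"

text \<open>Homomorphisms are normalised to be \<open>undefined\<close> outside the carrier, so that equality of
  functions is equality of homomorphisms.\<close>

definition lmod_hom ::
  "('r, 'e) ring_scheme \<Rightarrow> ('r, 'm, 'f) module_scheme \<Rightarrow> ('r, 'n, 'g) module_scheme \<Rightarrow> ('m \<Rightarrow> 'n) set" where
  "lmod_hom R M N = {f \<in> carrier M \<rightarrow>\<^sub>E carrier N.
     (\<forall>x\<in>carrier M. \<forall>y\<in>carrier M. f (x \<oplus>\<^bsub>M\<^esub> y) = f x \<oplus>\<^bsub>N\<^esub> f y) \<and>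
     (\<forall>a\<in>carrier R. \<forall>x\<in>carrier M. f (a \<odot>\<^bsub>M\<^esub> x) = a \<odot>\<^bsub>N\<^esub> f x)}"

text \<open>\<open>R-mod\<close>, relative to a type \<open>'u\<close> serving as universe: its objects are all left \<open>R\<close>-modules
  with carrier contained in \<open>'u\<close>. For infinite \<open>'u\<close> these are, up to isomorphism, all modules of
  cardinality at most that of \<open>'u\<close>; a finite \<open>'u\<close> is no reasonable universe, as it is not closed
  under direct sums.\<close>

definition lmod_cat :: "('r, 'e) ring_scheme \<Rightarrow> (('r, 'u) module, 'u \<Rightarrow> 'u) cat" where
  "lmod_cat R = \<lparr>Obj = {M. left_module R M}, Hom = lmod_hom R,
     Id = (\<lambda>M. \<lambda>x\<in>carrier M. x), Comp = (\<lambda>L M N g f. compose (carrier L) g f)\<rparr>"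

text \<open>Projectivity by the lifting property. A definition can only quantify over modules in fixed
  types; the types chosen here lose nothing, because the free \<open>R\<close>-module on the set \<open>carrier P\<close> lives
  in \<open>'p \<Rightarrow> 'r\<close>: lifting the identity of \<open>P\<close> through the canonical surjection from it exhibits \<open>P\<close> as
  a direct summand of a free module, which gives the lifting property for modules in all types.\<close>

definition projective :: "('r, 'e) ring_scheme \<Rightarrow> ('r, 'p) module \<Rightarrow> bool" where
  "projective R P \<longleftrightarrow> left_module R P \<and>
    (\<forall>(N :: ('r, 'p \<Rightarrow> 'r) module) (L :: ('r, 'p) module).
      left_module R N \<longrightarrow> left_module R L \<longrightarrow>
      (\<forall>g\<in>lmod_hom R N L. g ` carrier N = carrier L \<longrightarrow>
        (\<forall>f\<in>lmod_hom R P L. \<exists>h\<in>lmod_hom R P N. \<forall>x\<in>carrier P. g (h x) = f x)))"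

text \<open>Existence of a basis \<open>S\<close>: every element is a unique finite linear combination of elements
  of \<open>S\<close>.\<close>

definition free_module :: "('k, 'e) ring_scheme \<Rightarrow> ('k, 'm, 'f) module_scheme \<Rightarrow> bool" where
  "free_module K M \<longleftrightarrow> (\<exists>S\<subseteq>carrier M. \<forall>x\<in>carrier M.
     \<exists>!f. f \<in> S \<rightarrow>\<^sub>E carrier K \<and> finite {s \<in> S. f s \<noteq> \<zero>\<^bsub>K\<^esub>} \<and>
       x = (\<Oplus>\<^bsub>M\<^esub>s\<in>{s \<in> S. f s \<noteq> \<zero>\<^bsub>K\<^esub>}. f s \<odot>\<^bsub>M\<^esub> s))"

text \<open>Right \<open>R\<close>-modules are left modules over the opposite ring.\<close>

definition opposite_ring :: "('r, 'e) ring_scheme \<Rightarrow> ('r, 'e) ring_scheme" where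
  "opposite_ring R = R\<lparr>mult := \<lambda>x y. y \<otimes>\<^bsub>R\<^esub> x\<rparr>"

definition ideal_as_left_module :: "('r, 'e) ring_scheme \<Rightarrow> 'r set \<Rightarrow> ('r, 'r) module" where
  "ideal_as_left_module R I = \<lparr>carrier = I, mult = mult R, one = \<one>\<^bsub>R\<^esub>,
     zero = \<zero>\<^bsub>R\<^esub>, add = add R, smult = mult R\<rparr>"

abbreviation ideal_as_right_module :: "('r, 'e) ring_scheme \<Rightarrow> 'r set \<Rightarrow> ('r, 'r) module" where
  "ideal_as_right_module R I \<equiv> ideal_as_left_module (opposite_ring R) I"


section \<open>Algebras and homotopes\<close>

text \<open>The library locale \<^locale>\<open>algebra\<close> requires commutativity.\<close>

locale unital_algebra = module K A + A?: ring A for K (structure) and A (structure) +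
  assumes smult_mult_left:
      "\<lbrakk>k \<in> carrier K; x \<in> carrier A; y \<in> carrier A\<rbrakk> \<Longrightarrow>
      (k \<odot>\<^bsub>A\<^esub> x) \<otimes>\<^bsub>A\<^esub> y = k \<odot>\<^bsub>A\<^esub> (x \<otimes>\<^bsub>A\<^esub> y)"
    and smult_mult_right:
      "\<lbrakk>k \<in> carrier K; x \<in> carrier A; y \<in> carrier A\<rbrakk> \<Longrightarrow>
      x \<otimes>\<^bsub>A\<^esub> (k \<odot>\<^bsub>A\<^esub> y) = k \<odot>\<^bsub>A\<^esub> (x \<otimes>\<^bsub>A\<^esub> y)"

text \<open>The non-unital algebra \<open>A\<^sub>\<Delta>\<close>; its field \<open>one\<close> is meaningless.\<close>

definition homotope_plus :: "('k, 'a, 'f) module_scheme \<Rightarrow> 'a \<Rightarrow> ('k, 'a, 'f) module_scheme" where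
  "homotope_plus A \<Delta> = A\<lparr>mult := \<lambda>a b. a \<otimes>\<^bsub>A\<^esub> \<Delta> \<otimes>\<^bsub>A\<^esub> b\<rparr>"

text \<open>\<open>K \<cdot> 1 \<oplus> C\<close> for a non-unital \<open>K\<close>-algebra \<open>C\<close>; the field \<open>one\<close> of \<open>C\<close> is not used.\<close>

definition unitization :: "('k, 'e) ring_scheme \<Rightarrow> ('k, 'a, 'f) module_scheme \<Rightarrow> ('k \<times> 'a) ring" where
  "unitization K C = \<lparr>carrier = carrier K \<times> carrier C,
     mult = (\<lambda>(k, a) (l, b). (k \<otimes>\<^bsub>K\<^esub> l, k \<odot>\<^bsub>C\<^esub> b \<oplus>\<^bsub>C\<^esub> l \<odot>\<^bsub>C\<^esub> a \<oplus>\<^bsub>C\<^esub> a \<otimes>\<^bsub>C\<^esub> b)),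
     one = (\<one>\<^bsub>K\<^esub>, \<zero>\<^bsub>C\<^esub>),
     zero = (\<zero>\<^bsub>K\<^esub>, \<zero>\<^bsub>C\<^esub>),
     add = (\<lambda>(k, a) (l, b). (k \<oplus>\<^bsub>K\<^esub> l, a \<oplus>\<^bsub>C\<^esub> b))\<rparr>"

definition augmentation_ideal :: "('k, 'e) ring_scheme \<Rightarrow> ('k, 'a, 'f) module_scheme \<Rightarrow> ('k \<times> 'a) set" where
  "augmentation_ideal K C = {\<zero>\<^bsub>K\<^esub>} \<times> carrier C"

definition homotope :: "('k, 'e) ring_scheme \<Rightarrow> ('k, 'a, 'f) module_scheme \<Rightarrow> 'a \<Rightarrow> ('k \<times> 'a) ring" where
  "homotope K A \<Delta> = unitization K (homotope_plus A \<Delta>)"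

text \<open>Surjectivity of the multiplication map \<open>C \<otimes>\<^sub>K C \<rightarrow> C\<close>: the elements of the tensor product are
  the finite sums of pure tensors \<open>a \<otimes> b\<close>, which are mapped to the sums of the products \<open>a b\<close>.\<close>

definition mult_map_surjective :: "('k, 'a, 'f) module_scheme \<Rightarrow> bool" where
  "mult_map_surjective C \<longleftrightarrow> (\<forall>x\<in>carrier C. \<exists>(n::nat) a b.
     a \<in> {..<n} \<rightarrow> carrier C \<and> b \<in> {..<n} \<rightarrow> carrier C \<and> x = (\<Oplus>\<^bsub>C\<^esub>i\<in>{..<n}. a i \<otimes>\<^bsub>C\<^esub> b i))"

definition well_tempered :: "('k, 'e) ring_scheme \<Rightarrow> ('k, 'a, 'f) module_scheme \<Rightarrow> 'a \<Rightarrow> bool" where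
  "well_tempered K A \<Delta> \<longleftrightarrow> \<Delta> \<in> carrier A \<and>
    mult_map_surjective (homotope_plus A \<Delta>) \<and>
    projective (homotope K A \<Delta>)
      (ideal_as_left_module (homotope K A \<Delta>) (augmentation_ideal K (homotope_plus A \<Delta>))) \<and>
    projective (opposite_ring (homotope K A \<Delta>))
      (ideal_as_right_module (homotope K A \<Delta>) (augmentation_ideal K (homotope_plus A \<Delta>)))"


section \<open>Basic consistency facts\<close>

lemma category_lmod_cat: "category (lmod_cat R :: (('r, 'u) module, 'u \<Rightarrow> 'u) cat)"
proof
  fix L M N :: "('r, 'u) module" and f g
  assume "f \<in> Hom (lmod_cat R) L M" "g \<in> Hom (lmod_cat R) M N"
    and "L \<in> Obj (lmod_cat R)" "M \<in> Obj (lmod_cat R)"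
  then have f: "f \<in> lmod_hom R L M" and g: "g \<in> lmod_hom R M N"
    and "left_module R L" "left_module R M"
    by (auto simp: lmod_cat_def)
  interpret L: left_module R L by fact
  interpret M: left_module R M by fact
  show "Comp (lmod_cat R) L M N g f \<in> Hom (lmod_cat R) L N"
    using f g by (auto simp: lmod_cat_def lmod_hom_def compose_def PiE_iff)
next
  fix X :: "('r, 'u) module"
  assume "X \<in> Obj (lmod_cat R)"
  then interpret left_module R X by (simp add: lmod_cat_def)
  show "Id (lmod_cat R) X \<in> Hom (lmod_cat R) X X"
    by (auto simp: lmod_cat_def lmod_hom_def)
next
  fix X Y :: "('r, 'u) module" and f
  assume "f \<in> Hom (lmod_cat R) X Y"
  then have f: "f \<in> carrier X \<rightarrow> carrier Y" "f \<in> extensional (carrier X)"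
    by (auto simp: lmod_cat_def lmod_hom_def PiE_def)
  show "Comp (lmod_cat R) X X Y f (Id (lmod_cat R) X) = f"
    using f by (simp add: lmod_cat_def compose_Id)
  show "Comp (lmod_cat R) X Y Y (Id (lmod_cat R) Y) f = f"
    using f by (simp add: lmod_cat_def Id_compose)
next
  fix W X Y Z :: "('r, 'u) module" and f g h
  assume "f \<in> Hom (lmod_cat R) W X"
  then have "f \<in> carrier W \<rightarrow> carrier X"
    by (auto simp: lmod_cat_def lmod_hom_def)
  then show "Comp (lmod_cat R) W X Z (Comp (lmod_cat R) X Y Z h g) f =
      Comp (lmod_cat R) W Y Z h (Comp (lmod_cat R) W X Y g f)"
    by (simp add: lmod_cat_def compose_assoc [symmetric])
qed

lemma ring_opposite_ring: "ring R \<Longrightarrow> ring (opposite_ring R)"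
proof -
  assume "ring R"
  then interpret ring R .
  have "abelian_group (opposite_ring R)"
    by (rule abelian_groupI)
      (auto simp: opposite_ring_def a_ac intro: l_neg)
  moreover have "monoid (opposite_ring R)"
    by (rule monoidI) (auto simp: opposite_ring_def m_assoc)
  ultimately show ?thesis
    by (intro ringI) (auto simp: opposite_ring_def l_distr r_distr)
qed

lemma module_imp_left_module: "module K M \<Longrightarrow> left_module K M"
proof -
  assume "module K M"
  then interpret module K M .
  show ?thesis
    by unfold_locales (auto simp: smult_l_distr smult_r_distr smult_assoc1)
qed

context unital_algebra
begin

lemma ring_homotope:
  assumes D: "\<Delta> \<in> carrier A"
  shows "ring (homotope K A \<Delta>)"
proof (rule ringI)
  note defs = homotope_def unitization_def homotope_plus_def
  show "abelian_group (homotope K A \<Delta>)"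
  proof (rule abelian_groupI)
    fix x assume "x \<in> carrier (homotope K A \<Delta>)"
    then show "\<exists>y\<in>carrier (homotope K A \<Delta>). y \<oplus>\<^bsub>homotope K A \<Delta>\<^esub> x = \<zero>\<^bsub>homotope K A \<Delta>\<^esub>"
      by (intro bexI[of _ "(\<ominus>\<^bsub>K\<^esub> fst x, \<ominus>\<^bsub>A\<^esub> snd x)"]) (auto simp: defs R.l_neg M.l_neg)
  qed (auto simp: defs R.a_ac M.a_ac)
  show "monoid (homotope K A \<Delta>)"
    by (rule monoidI)
      (use D in \<open>auto simp: defs R.m_ac M.a_ac A.m_assoc A.l_distr A.r_distr smult_r_distr
        smult_l_distr smult_assoc1 [symmetric] smult_mult_left smult_mult_right\<close>)
qed (use assms in \<open>auto simp: homotope_def unitization_def homotope_plus_def R.l_distr R.r_distr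
       A.l_distr A.r_distr smult_l_distr smult_r_distr M.a_ac\<close>)

lemma ideal_augmentation_ideal:
  assumes D: "\<Delta> \<in> carrier A"
  shows "ideal (augmentation_ideal K (homotope_plus A \<Delta>)) (homotope K A \<Delta>)"
proof (rule idealI)
  interpret B: ring "homotope K A \<Delta>" by (rule ring_homotope[OF D])
  note defs = homotope_def unitization_def homotope_plus_def augmentation_ideal_def
  show "ring (homotope K A \<Delta>)" by (rule ring_homotope[OF D])
  show "subgroup (augmentation_ideal K (homotope_plus A \<Delta>)) (add_monoid (homotope K A \<Delta>))"
  proof (rule group.subgroupI)
    show "group (add_monoid (homotope K A \<Delta>))" by (rule B.a_group)
    fix x assume x: "x \<in> augmentation_ideal K (homotope_plus A \<Delta>)"
    then have "\<ominus>\<^bsub>homotope K A \<Delta>\<^esub> x = (\<zero>\<^bsub>K\<^esub>, \<ominus>\<^bsub>A\<^esub> snd x)"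
      by (intro B.minus_equality) (auto simp: defs M.l_neg)
    with x show "inv\<^bsub>add_monoid (homotope K A \<Delta>)\<^esub> x \<in> augmentation_ideal K (homotope_plus A \<Delta>)"
      unfolding a_inv_def [of "homotope K A \<Delta>"] by (auto simp: augmentation_ideal_def homotope_plus_def)
  qed (auto simp: defs)
qed (use D in \<open>auto simp: homotope_def unitization_def homotope_plus_def augmentation_ideal_def\<close>)

end

lemma left_module_ideal:
  assumes "ideal I R"
  shows "left_module R (ideal_as_left_module R I)"
proof -
  interpret ideal I R by fact
  have "abelian_group (ideal_as_left_module R I)"
  proof (rule abelian_groupI)
    fix x assume x: "x \<in> carrier (ideal_as_left_module R I)"
    then have "\<ominus>\<^bsub>R\<^esub> x \<in> I" "\<ominus>\<^bsub>R\<^esub> x \<oplus>\<^bsub>R\<^esub> x = \<zero>\<^bsub>R\<^esub>"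
      by (auto simp: ideal_as_left_module_def l_neg)
    then show "\<exists>y\<in>carrier (ideal_as_left_module R I).
        y \<oplus>\<^bsub>ideal_as_left_module R I\<^esub> x = \<zero>\<^bsub>ideal_as_left_module R I\<^esub>"
      by (auto simp: ideal_as_left_module_def)
  qed (auto simp: ideal_as_left_module_def a_ac)
  then show ?thesis
    by (intro left_module.intro left_module_axioms.intro)
      (auto simp: ideal_as_left_module_def ring_axioms I_l_closed m_assoc l_distr r_distr)
qed

end

theory Submission
  imports Defs
begin

text \<open>
  For a \<open>B\<close>-module \<open>V\<close> let \<open>W = Hom\<^sub>B(B\<^sup>+, V)\<close>, an \<open>A\<close>-module, and let \<open>f \<phi> = \<phi> 1\<close> and \<open>g x = (b \<mapsto> b x)\<close>.
  The maps \<open>f : W \<rightarrow> V\<close>, \<open>g : V \<rightarrow> W\<close> satisfy \<open>g f = \<Delta>\<close>, and \<open>a \<in> B\<^sup>+\<close> acts on \<open>V\<close> as \<open>f a g\<close>; because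
  \<open>A \<Delta> A = A\<close>, the factorization \<open>W \<rightarrow> V \<rightarrow> W\<close> of \<open>\<Delta>\<close> is the same information as \<open>V\<close>.
  The hypotheses say that \<open>\<Delta>\<close> and \<open>\<Delta>'\<close> are homotopy equivalent two-term complexes, so \<open>\<Delta> \<oplus> 1\<close>
  and \<open>\<Delta>' \<oplus> 1\<close> agree up to invertible \<open>2 \<times> 2\<close> matrices over \<open>A\<close>:
  \<open>S (\<Delta> \<oplus> 1) = (\<Delta>' \<oplus> 1) T\<close> with \<open>S = ((c, \<Delta>'), (h\<^sub>2, v))\<close> and \<open>T = ((d, 1), (h\<^sub>2 \<Delta>, v))\<close>.
  Stabilize the factorization to \<open>W \<oplus> W \<rightarrow> V \<oplus> W \<rightarrow> W \<oplus> W\<close>, change bases by \<open>S\<close> and \<open>T\<close>, and split off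
  the summand on which the composite is \<open>1\<close>: what remains is a factorization \<open>W \<rightarrow> V' \<rightarrow> W\<close> of \<open>\<Delta>'\<close>,
  where \<open>V'\<close> is the kernel of \<open>(h\<^sub>2 g, v) : V \<oplus> W \<rightarrow> W\<close>.
  As \<open>1\<close> is a finite sum \<open>\<Sum> x\<^sub>i \<Delta> y\<^sub>i\<close>, an element \<open>\<phi>\<close> of \<open>W\<close> is determined by the values \<open>\<phi> y\<^sub>i\<close>, hence \<open>V'\<close>
  again fits into the infinite universe that contains \<open>V\<close>.
\<close>


section \<open>Module homomorphisms and transport of structure\<close>

lemma lmod_hom_iff:
  "h \<in> lmod_hom R M N \<longleftrightarrow> h \<in> carrier M \<rightarrow>\<^sub>E carrier N \<and>
     (\<forall>x\<in>carrier M. \<forall>y\<in>carrier M. h (x \<oplus>\<^bsub>M\<^esub> y) = h x \<oplus>\<^bsub>N\<^esub> h y) \<and>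
     (\<forall>a\<in>carrier R. \<forall>x\<in>carrier M. h (a \<odot>\<^bsub>M\<^esub> x) = a \<odot>\<^bsub>N\<^esub> h x)"
  by (simp add: lmod_hom_def)

lemma lmod_hom_closed: "h \<in> lmod_hom R M N \<Longrightarrow> x \<in> carrier M \<Longrightarrow> h x \<in> carrier N"
  by (auto simp: lmod_hom_def)

lemma lmod_hom_add:
  "h \<in> lmod_hom R M N \<Longrightarrow> x \<in> carrier M \<Longrightarrow> y \<in> carrier M \<Longrightarrow> h (x \<oplus>\<^bsub>M\<^esub> y) = h x \<oplus>\<^bsub>N\<^esub> h y"
  by (auto simp: lmod_hom_def)

lemma lmod_hom_smult:
  "h \<in> lmod_hom R M N \<Longrightarrow> a \<in> carrier R \<Longrightarrow> x \<in> carrier M \<Longrightarrow> h (a \<odot>\<^bsub>M\<^esub> x) = a \<odot>\<^bsub>N\<^esub> h x"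
  by (auto simp: lmod_hom_def)

section \<open>Additive maps between abelian groups\<close>

lemma additive_zero:
  assumes "abelian_group G" "abelian_group H"
    and "\<And>x. x \<in> carrier G \<Longrightarrow> h x \<in> carrier H"
    and "\<And>x y. x \<in> carrier G \<Longrightarrow> y \<in> carrier G \<Longrightarrow> h (x \<oplus>\<^bsub>G\<^esub> y) = h x \<oplus>\<^bsub>H\<^esub> h y"
  shows "h \<zero>\<^bsub>G\<^esub> = \<zero>\<^bsub>H\<^esub>"
proof -
  interpret G: abelian_group G by fact
  interpret H: abelian_group H by fact
  have "h \<zero>\<^bsub>G\<^esub> \<oplus>\<^bsub>H\<^esub> h \<zero>\<^bsub>G\<^esub> = h \<zero>\<^bsub>G\<^esub>"
    using assms(3,4)[of "\<zero>\<^bsub>G\<^esub>"] by (metis G.r_zero G.zero_closed)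
  then show ?thesis using assms(3) by simp
qed

lemma additive_minus:
  assumes "abelian_group G" "abelian_group H"
    and "\<And>x. x \<in> carrier G \<Longrightarrow> h x \<in> carrier H"
    and "\<And>x y. x \<in> carrier G \<Longrightarrow> y \<in> carrier G \<Longrightarrow> h (x \<oplus>\<^bsub>G\<^esub> y) = h x \<oplus>\<^bsub>H\<^esub> h y"
    and "x \<in> carrier G"
  shows "h (\<ominus>\<^bsub>G\<^esub> x) = \<ominus>\<^bsub>H\<^esub> h x"
proof -
  interpret G: abelian_group G by fact
  interpret H: abelian_group H by fact
  have "h (\<ominus>\<^bsub>G\<^esub> x) \<oplus>\<^bsub>H\<^esub> h x = \<zero>\<^bsub>H\<^esub>"
    using additive_zero[of G H h] assms by (metis G.a_inv_closed G.l_neg)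
  then show ?thesis using assms(3,5) by (metis G.a_inv_closed H.minus_equality)
qed

lemma additive_finsum:
  assumes "abelian_group G" "abelian_group H"
    and "\<And>x. x \<in> carrier G \<Longrightarrow> h x \<in> carrier H"
    and "\<And>x y. x \<in> carrier G \<Longrightarrow> y \<in> carrier G \<Longrightarrow> h (x \<oplus>\<^bsub>G\<^esub> y) = h x \<oplus>\<^bsub>H\<^esub> h y"
    and "finite S" "f \<in> S \<rightarrow> carrier G"
  shows "h (finsum G f S) = finsum H (\<lambda>i. h (f i)) S"
proof -
  interpret G: abelian_group G by fact
  interpret H: abelian_group H by fact
  show ?thesis using assms(5,6)
  proof (induction S rule: finite_induct)
    case empty
    then show ?case using additive_zero[of G H h] assms by simp
  next
    case (insert i S)
    then have f: "f \<in> S \<rightarrow> carrier G" "f i \<in> carrier G" by auto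
    then have hf: "(\<lambda>i. h (f i)) \<in> S \<rightarrow> carrier H" using assms(3) by auto
    show ?case
      using insert f hf assms(3,4) G.finsum_closed[OF f(1)] by simp
  qed
qed

lemma lmod_hom_comp:
  assumes "f \<in> lmod_hom R L M" "g \<in> lmod_hom R M N" "left_module R L"
  shows "compose (carrier L) g f \<in> lmod_hom R L N"
proof -
  interpret L: left_module R L by fact
  show ?thesis using assms(1,2) by (auto simp: lmod_hom_def compose_def PiE_iff)
qed

section \<open>Isomorphisms of modules and natural isomorphisms with the identity functor\<close>

definition lmod_iso ::
  "('r, 'e) ring_scheme \<Rightarrow> ('r, 'm, 'f) module_scheme \<Rightarrow> ('r, 'n, 'g) module_scheme \<Rightarrow> ('m \<Rightarrow> 'n) set" where
  "lmod_iso R M N = {h \<in> lmod_hom R M N. bij_betw h (carrier M) (carrier N)}"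

lemma lmod_iso_comp:
  assumes "f \<in> lmod_iso R L M" "g \<in> lmod_iso R M N" "left_module R L"
  shows "compose (carrier L) g f \<in> lmod_iso R L N"
  using assms lmod_hom_comp[of f R L M g N] bij_betw_compose
  by (auto simp: lmod_iso_def)

lemma lmod_iso_inv:
  assumes "h \<in> lmod_iso R M N" "left_module R M"
  shows "restrict (inv_into (carrier M) h) (carrier N) \<in> lmod_iso R N M"
proof -
  interpret M: left_module R M by fact
  have h: "h \<in> lmod_hom R M N" and b: "bij_betw h (carrier M) (carrier N)"
    using assms by (auto simp: lmod_iso_def)
  let ?i = "inv_into (carrier M) h"
  have inj: "inj_on h (carrier M)" and im: "h ` carrier M = carrier N"
    using b by (auto simp: bij_betw_def)
  have bi: "bij_betw ?i (carrier N) (carrier M)" by (rule bij_betw_inv_into[OF b])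
  have "restrict ?i (carrier N) \<in> lmod_hom R N M"
    unfolding lmod_hom_iff
  proof (intro conjI ballI)
    show "restrict ?i (carrier N) \<in> carrier N \<rightarrow>\<^sub>E carrier M"
      using bi by (auto simp: bij_betw_def)
  next
    fix y y' assume "y \<in> carrier N" "y' \<in> carrier N"
    then obtain x x' where x: "x \<in> carrier M" "x' \<in> carrier M" "y = h x" "y' = h x'"
      using im by (metis imageE)
    moreover have "y \<oplus>\<^bsub>N\<^esub> y' = h (x \<oplus>\<^bsub>M\<^esub> x')" using x h by (simp add: lmod_hom_add)
    ultimately show "restrict ?i (carrier N) (y \<oplus>\<^bsub>N\<^esub> y') =
        restrict ?i (carrier N) y \<oplus>\<^bsub>M\<^esub> restrict ?i (carrier N) y'"
      using lmod_hom_closed[OF h] inj by simp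
  next
    fix a y assume a: "a \<in> carrier R" and "y \<in> carrier N"
    then obtain x where x: "x \<in> carrier M" "y = h x" using im by (metis imageE)
    moreover have "a \<odot>\<^bsub>N\<^esub> y = h (a \<odot>\<^bsub>M\<^esub> x)" using x h a by (simp add: lmod_hom_smult)
    ultimately show "restrict ?i (carrier N) (a \<odot>\<^bsub>N\<^esub> y) = a \<odot>\<^bsub>M\<^esub> restrict ?i (carrier N) y"
      using lmod_hom_closed[OF h] inj a by simp
  qed
  then show ?thesis using bi by (simp add: lmod_iso_def cong: bij_betw_cong)
qed

lemma is_iso_lmod_iso_inv:
  fixes M N :: "('r, 'u) module"
  assumes "h \<in> lmod_iso R M N" "left_module R M"
  shows "is_iso (lmod_cat R) N M (restrict (inv_into (carrier M) h) (carrier N))"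
proof -
  let ?i = "restrict (inv_into (carrier M) h) (carrier N)"
  have i: "?i \<in> lmod_hom R N M" using lmod_iso_inv[OF assms] by (simp add: lmod_iso_def)
  have h: "h \<in> lmod_hom R M N" and b: "bij_betw h (carrier M) (carrier N)"
    using assms by (auto simp: lmod_iso_def)
  have 1: "compose (carrier M) ?i h = (\<lambda>x\<in>carrier M. x)"
    using b lmod_hom_closed[OF h] by (auto simp: compose_def fun_eq_iff bij_betw_def)
  have 2: "compose (carrier N) h ?i = (\<lambda>x\<in>carrier N. x)"
    using b by (auto simp: compose_def fun_eq_iff bij_betw_def f_inv_into_f)
  show "is_iso (lmod_cat R) N M ?i"
    unfolding is_iso_def lmod_cat_def using h i 1 2 by auto
qed

text \<open>Comparison maps are constructed in the direction \<open>X \<rightarrow> T X\<close>,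
  whereas a natural isomorphism from \<open>T\<close> to the identity has components
  \<open>T X \<rightarrow> X\<close>; hence the passage to inverses. Naturality of the inverses is
  checked on elements \<open>\<theta> X x\<close>, which is enough because \<open>\<theta> X\<close>
  is onto.\<close>

lemma naturally_isomorphic_id_lmod_catI:
  fixes T :: "(('r, 'u) module, 'u \<Rightarrow> 'u, ('r, 'u) module, 'u \<Rightarrow> 'u) fctr"
  assumes iso: "\<And>X. left_module R X \<Longrightarrow> \<theta> X \<in> lmod_iso R X (on_obj T X)"
    and nat: "\<And>X Y h x. \<lbrakk>left_module R X; left_module R Y; h \<in> lmod_hom R X Y; x \<in> carrier X\<rbrakk> \<Longrightarrow>
      \<theta> Y (h x) = on_hom T X Y h (\<theta> X x)"
  shows "naturally_isomorphic (lmod_cat R) (lmod_cat R) T id_functor"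
proof -
  define \<eta> where "\<eta> X = restrict (inv_into (carrier X) (\<theta> X)) (carrier (on_obj T X))" for X
  have "Comp (lmod_cat R) (on_obj T X) (on_obj T Y) Y (\<eta> Y) (on_hom T X Y h) =
      Comp (lmod_cat R) (on_obj T X) X Y h (\<eta> X)"
    if X: "left_module R X" and Y: "left_module R Y" and h: "h \<in> lmod_hom R X Y" for X Y h
  proof -
    have b: "bij_betw (\<theta> X) (carrier X) (carrier (on_obj T X))" using iso[OF X] by (auto simp: lmod_iso_def)
    have b': "inj_on (\<theta> Y) (carrier Y)"
      and t: "\<theta> Y \<in> lmod_hom R Y (on_obj T Y)" using iso[OF Y] by (auto simp: lmod_iso_def bij_betw_def)
    have "\<eta> Y (on_hom T X Y h z) = h (\<eta> X z)" if z: "z \<in> carrier (on_obj T X)" for z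
    proof -
      obtain x where x: "x \<in> carrier X" "z = \<theta> X x" using b z by (auto simp: bij_betw_def)
      have "on_hom T X Y h z = \<theta> Y (h x)" using nat[OF X Y h x(1)] x by simp
      moreover have "\<eta> X z = x" using x b z by (simp add: \<eta>_def bij_betw_def)
      ultimately show ?thesis
        using lmod_hom_closed[OF h x(1)] lmod_hom_closed[OF t] b' by (simp add: \<eta>_def)
    qed
    then show ?thesis by (auto simp: lmod_cat_def compose_def)
  qed
  moreover have "is_iso (lmod_cat R) (on_obj T X) X (\<eta> X)" if "left_module R X" for X
    unfolding \<eta>_def by (rule is_iso_lmod_iso_inv[OF iso[OF that] that])
  ultimately show ?thesis
    unfolding naturally_isomorphic_def
    by (intro exI[of _ \<eta>]) (simp add: lmod_cat_def id_functor_def)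
qed

text \<open>Moves a module along an injection, later from pairs of an element and a function back
  into the universe type \<open>'u\<close>. \<open>\<kappa>\<close> inverts \<open>\<iota>\<close>
  on the carrier only, so the operations are meaningful just for \<open>\<iota>\<close> injective
  there.\<close>

definition transport_module :: "('m \<Rightarrow> 'n) \<Rightarrow> ('r, 'm) module \<Rightarrow> ('r, 'n) module" where
  "transport_module \<iota> M = (let \<kappa> = inv_into (carrier M) \<iota> in
     \<lparr>carrier = \<iota> ` carrier M, mult = undefined, one = undefined, zero = \<iota> \<zero>\<^bsub>M\<^esub>,
      add = (\<lambda>x y. \<iota> (\<kappa> x \<oplus>\<^bsub>M\<^esub> \<kappa> y)), smult = (\<lambda>a x. \<iota> (a \<odot>\<^bsub>M\<^esub> \<kappa> x))\<rparr>)"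

lemma carrier_transport_module: "carrier (transport_module \<iota> M) = \<iota> ` carrier M"
  by (simp add: transport_module_def Let_def)

lemma transport_module:
  assumes "left_module R M" "inj_on \<iota> (carrier M)"
  shows "left_module R (transport_module \<iota> M)"
    and "restrict \<iota> (carrier M) \<in> lmod_iso R M (transport_module \<iota> M)"
proof -
  interpret M: left_module R M by fact
  let ?N = "transport_module \<iota> M"
  have [simp]: "inv_into (carrier M) \<iota> (\<iota> x) = x" if "x \<in> carrier M" for x
    using assms(2) that by simp
  have add: "\<iota> x \<oplus>\<^bsub>?N\<^esub> \<iota> y = \<iota> (x \<oplus>\<^bsub>M\<^esub> y)" if "x \<in> carrier M" "y \<in> carrier M" for x y
    using that by (simp add: transport_module_def Let_def)
  have sm: "a \<odot>\<^bsub>?N\<^esub> \<iota> x = \<iota> (a \<odot>\<^bsub>M\<^esub> x)" if "x \<in> carrier M" for x a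
    using that by (simp add: transport_module_def Let_def)
  have car: "carrier ?N = \<iota> ` carrier M" and z: "\<zero>\<^bsub>?N\<^esub> = \<iota> \<zero>\<^bsub>M\<^esub>"
    by (simp_all add: transport_module_def Let_def)
  have "abelian_group ?N"
  proof (rule abelian_groupI)
    fix x assume "x \<in> carrier ?N"
    then obtain x' where x': "x' \<in> carrier M" "x = \<iota> x'" by (auto simp: car)
    then show "\<exists>y\<in>carrier ?N. y \<oplus>\<^bsub>?N\<^esub> x = \<zero>\<^bsub>?N\<^esub>"
      by (intro bexI[of _ "\<iota> (\<ominus>\<^bsub>M\<^esub> x')"]) (auto simp: car z add M.l_neg)
  qed (auto simp: car z add M.a_ac)
  then show "left_module R ?N"
    by (intro left_module.intro left_module_axioms.intro M.ring_axioms)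
      (auto simp: car add sm M.smult_l_distr M.smult_r_distr M.smult_assoc1)
  show "restrict \<iota> (carrier M) \<in> lmod_iso R M ?N"
    using assms(2)
    by (auto simp: lmod_iso_def lmod_hom_def car add sm bij_betw_def inj_on_def)
qed

section \<open>Modules over a homotope\<close>

context unital_algebra
begin

text \<open>Together with \<open>ract\<close> this restricts the action of the homotope to its two
  summands \<open>K\<close> and \<open>B\<^sup>+\<close>, so that calculations need no
  pairs.\<close>

definition sact where "sact V k x = (k, \<zero>\<^bsub>A\<^esub>) \<odot>\<^bsub>V\<^esub> x"

definition ract where "ract V a x = (\<zero>\<^bsub>K\<^esub>, a) \<odot>\<^bsub>V\<^esub> x"

text \<open>The module \<open>Hom\<^sub>B(B\<^sup>+, V)\<close>, whose elements are functions on \<open>A = B\<^sup>+\<close>. Right multiplication in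
  \<open>A\<close> makes it a left \<open>A\<close>-module, with action \<open>shift\<close>.\<close>

definition plus_homs where
  "plus_homs \<Delta> V = {\<phi> \<in> carrier A \<rightarrow>\<^sub>E carrier V.
     (\<forall>a\<in>carrier A. \<forall>b\<in>carrier A. \<phi> (a \<oplus>\<^bsub>A\<^esub> b) = \<phi> a \<oplus>\<^bsub>V\<^esub> \<phi> b) \<and>
     (\<forall>k\<in>carrier K. \<forall>a\<in>carrier A. \<phi> (k \<odot>\<^bsub>A\<^esub> a) = sact V k (\<phi> a)) \<and>
     (\<forall>a\<in>carrier A. \<forall>b\<in>carrier A. \<phi> (a \<otimes>\<^bsub>A\<^esub> \<Delta> \<otimes>\<^bsub>A\<^esub> b) = ract V a (\<phi> b))}"

definition shift where "shift a \<phi> = (\<lambda>b\<in>carrier A. \<phi> (b \<otimes>\<^bsub>A\<^esub> a))"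

lemmas homotope_defs = homotope_def unitization_def homotope_plus_def

lemma homotope_simps [simp]:
  "carrier (homotope K A \<Delta>) = carrier K \<times> carrier A"
  "(k, a) \<oplus>\<^bsub>homotope K A \<Delta>\<^esub> (l, b) = (k \<oplus>\<^bsub>K\<^esub> l, a \<oplus>\<^bsub>A\<^esub> b)"
  "(k, a) \<otimes>\<^bsub>homotope K A \<Delta>\<^esub> (l, b) =
     (k \<otimes>\<^bsub>K\<^esub> l, k \<odot>\<^bsub>A\<^esub> b \<oplus>\<^bsub>A\<^esub> l \<odot>\<^bsub>A\<^esub> a \<oplus>\<^bsub>A\<^esub> a \<otimes>\<^bsub>A\<^esub> \<Delta> \<otimes>\<^bsub>A\<^esub> b)"
  "\<one>\<^bsub>homotope K A \<Delta>\<^esub> = (\<one>\<^bsub>K\<^esub>, \<zero>\<^bsub>A\<^esub>)"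
  by (simp_all add: homotope_defs)

text \<open>Expanding the product \<open>(k, a) (l, b) = (k l, k b + l a + a \<Delta> b)\<close>
  shows which laws the two actions must satisfy; the mixed terms are handled by the last two
  assumptions. In turn \<open>s\<close> and \<open>r\<close> are recovered from the module, since
  additive maps send zero to zero.\<close>

lemma left_module_homotopeI:
  assumes \<Delta>: "\<Delta> \<in> carrier A" and "abelian_group V"
    and smult: "\<And>k a x. \<lbrakk>k \<in> carrier K; a \<in> carrier A; x \<in> carrier V\<rbrakk> \<Longrightarrow>
      (k, a) \<odot>\<^bsub>V\<^esub> x = s k x \<oplus>\<^bsub>V\<^esub> r a x"
    and s: "\<And>k x. \<lbrakk>k \<in> carrier K; x \<in> carrier V\<rbrakk> \<Longrightarrow> s k x \<in> carrier V"
      "\<And>k l x. \<lbrakk>k \<in> carrier K; l \<in> carrier K; x \<in> carrier V\<rbrakk> \<Longrightarrow> s (k \<oplus>\<^bsub>K\<^esub> l) x = s k x \<oplus>\<^bsub>V\<^esub> s l x"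
      "\<And>k x y. \<lbrakk>k \<in> carrier K; x \<in> carrier V; y \<in> carrier V\<rbrakk> \<Longrightarrow> s k (x \<oplus>\<^bsub>V\<^esub> y) = s k x \<oplus>\<^bsub>V\<^esub> s k y"
      "\<And>k l x. \<lbrakk>k \<in> carrier K; l \<in> carrier K; x \<in> carrier V\<rbrakk> \<Longrightarrow> s (k \<otimes>\<^bsub>K\<^esub> l) x = s k (s l x)"
      "\<And>x. x \<in> carrier V \<Longrightarrow> s \<one>\<^bsub>K\<^esub> x = x"
    and r: "\<And>a x. \<lbrakk>a \<in> carrier A; x \<in> carrier V\<rbrakk> \<Longrightarrow> r a x \<in> carrier V"
      "\<And>a b x. \<lbrakk>a \<in> carrier A; b \<in> carrier A; x \<in> carrier V\<rbrakk> \<Longrightarrow> r (a \<oplus>\<^bsub>A\<^esub> b) x = r a x \<oplus>\<^bsub>V\<^esub> r b x"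
      "\<And>a x y. \<lbrakk>a \<in> carrier A; x \<in> carrier V; y \<in> carrier V\<rbrakk> \<Longrightarrow> r a (x \<oplus>\<^bsub>V\<^esub> y) = r a x \<oplus>\<^bsub>V\<^esub> r a y"
      "\<And>a b x. \<lbrakk>a \<in> carrier A; b \<in> carrier A; x \<in> carrier V\<rbrakk> \<Longrightarrow>
        r (a \<otimes>\<^bsub>A\<^esub> \<Delta> \<otimes>\<^bsub>A\<^esub> b) x = r a (r b x)"
    and sr: "\<And>k a x. \<lbrakk>k \<in> carrier K; a \<in> carrier A; x \<in> carrier V\<rbrakk> \<Longrightarrow> s k (r a x) = r (k \<odot>\<^bsub>A\<^esub> a) x"
      "\<And>k a x. \<lbrakk>k \<in> carrier K; a \<in> carrier A; x \<in> carrier V\<rbrakk> \<Longrightarrow> r a (s k x) = r (k \<odot>\<^bsub>A\<^esub> a) x"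
  shows "left_module (homotope K A \<Delta>) V"
    and "\<And>k x. \<lbrakk>k \<in> carrier K; x \<in> carrier V\<rbrakk> \<Longrightarrow> sact V k x = s k x"
    and "\<And>a x. \<lbrakk>a \<in> carrier A; x \<in> carrier V\<rbrakk> \<Longrightarrow> ract V a x = r a x"
proof -
  interpret V: abelian_group V by fact
  have r0: "r \<zero>\<^bsub>A\<^esub> x = \<zero>\<^bsub>V\<^esub>" if "x \<in> carrier V" for x
    by (rule additive_zero[OF M.abelian_group_axioms V.abelian_group_axioms]) (simp_all add: r that)
  have s0: "s \<zero>\<^bsub>K\<^esub> x = \<zero>\<^bsub>V\<^esub>" if "x \<in> carrier V" for x
    by (rule additive_zero[OF R.abelian_group_axioms V.abelian_group_axioms]) (simp_all add: s that)
  show "left_module (homotope K A \<Delta>) V"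
    by (intro left_module.intro left_module_axioms.intro ring_homotope[OF \<Delta>] V.abelian_group_axioms)
      (auto simp: smult s r sr r0 \<Delta> V.a_ac)
  show "sact V k x = s k x" if "k \<in> carrier K" "x \<in> carrier V" for k x
    using that by (simp add: sact_def smult r0 s)
  show "ract V a x = r a x" if "a \<in> carrier A" "x \<in> carrier V" for a x
    using that by (simp add: ract_def smult s0 r)
qed

end

section \<open>Calculation in a module over the homotope and in
  \<open>Hom\<^sub>B(B\<^sup>+, V)\<close>\<close>

locale homotope_module = unital_algebra K A + V: left_module "homotope K A \<Delta>" V
  for K (structure) and A (structure) and \<Delta> and V (structure) +
  assumes Delta_closed [simp]: "\<Delta> \<in> carrier A"
begin

lemma sact_closed [simp]: "k \<in> carrier K \<Longrightarrow> x \<in> carrier V \<Longrightarrow> sact V k x \<in> carrier V"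
  by (simp add: sact_def)

lemma ract_closed [simp]: "a \<in> carrier A \<Longrightarrow> x \<in> carrier V \<Longrightarrow> ract V a x \<in> carrier V"
  by (simp add: ract_def)

lemma sact_add_left:
  "k \<in> carrier K \<Longrightarrow> l \<in> carrier K \<Longrightarrow> x \<in> carrier V \<Longrightarrow>
    sact V (k \<oplus>\<^bsub>K\<^esub> l) x = sact V k x \<oplus>\<^bsub>V\<^esub> sact V l x"
  using V.smult_l_distr[of "(k, \<zero>\<^bsub>A\<^esub>)" "(l, \<zero>\<^bsub>A\<^esub>)" x] by (simp add: sact_def)

lemma ract_add_left:
  "a \<in> carrier A \<Longrightarrow> b \<in> carrier A \<Longrightarrow> x \<in> carrier V \<Longrightarrow>
    ract V (a \<oplus>\<^bsub>A\<^esub> b) x = ract V a x \<oplus>\<^bsub>V\<^esub> ract V b x"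
  using V.smult_l_distr[of "(\<zero>\<^bsub>K\<^esub>, a)" "(\<zero>\<^bsub>K\<^esub>, b)" x] by (simp add: ract_def)

lemma sact_add:
  "k \<in> carrier K \<Longrightarrow> x \<in> carrier V \<Longrightarrow> y \<in> carrier V \<Longrightarrow>
    sact V k (x \<oplus>\<^bsub>V\<^esub> y) = sact V k x \<oplus>\<^bsub>V\<^esub> sact V k y"
  by (simp add: sact_def V.smult_r_distr)

lemma ract_add:
  "a \<in> carrier A \<Longrightarrow> x \<in> carrier V \<Longrightarrow> y \<in> carrier V \<Longrightarrow>
    ract V a (x \<oplus>\<^bsub>V\<^esub> y) = ract V a x \<oplus>\<^bsub>V\<^esub> ract V a y"
  by (simp add: ract_def V.smult_r_distr)

lemma sact_sact:
  "k \<in> carrier K \<Longrightarrow> l \<in> carrier K \<Longrightarrow> x \<in> carrier V \<Longrightarrow> sact V k (sact V l x) = sact V (k \<otimes>\<^bsub>K\<^esub> l) x"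
  using V.smult_assoc1[of "(k, \<zero>\<^bsub>A\<^esub>)" "(l, \<zero>\<^bsub>A\<^esub>)" x] by (simp add: sact_def)

lemma sact_one [simp]: "x \<in> carrier V \<Longrightarrow> sact V \<one>\<^bsub>K\<^esub> x = x"
  using V.smult_one[of x] by (simp add: sact_def)

lemma ract_ract:
  "a \<in> carrier A \<Longrightarrow> b \<in> carrier A \<Longrightarrow> x \<in> carrier V \<Longrightarrow>
    ract V a (ract V b x) = ract V (a \<otimes>\<^bsub>A\<^esub> \<Delta> \<otimes>\<^bsub>A\<^esub> b) x"
  using V.smult_assoc1[of "(\<zero>\<^bsub>K\<^esub>, a)" "(\<zero>\<^bsub>K\<^esub>, b)" x] by (simp add: ract_def)

lemma sact_ract:
  "k \<in> carrier K \<Longrightarrow> a \<in> carrier A \<Longrightarrow> x \<in> carrier V \<Longrightarrow> sact V k (ract V a x) = ract V (k \<odot>\<^bsub>A\<^esub> a) x"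
  using V.smult_assoc1[of "(k, \<zero>\<^bsub>A\<^esub>)" "(\<zero>\<^bsub>K\<^esub>, a)" x] by (simp add: ract_def sact_def)

lemma ract_sact:
  "k \<in> carrier K \<Longrightarrow> a \<in> carrier A \<Longrightarrow> x \<in> carrier V \<Longrightarrow> ract V a (sact V k x) = ract V (k \<odot>\<^bsub>A\<^esub> a) x"
  using V.smult_assoc1[of "(\<zero>\<^bsub>K\<^esub>, a)" "(k, \<zero>\<^bsub>A\<^esub>)" x] by (simp add: ract_def sact_def)

lemma smult_eq:
  "k \<in> carrier K \<Longrightarrow> a \<in> carrier A \<Longrightarrow> x \<in> carrier V \<Longrightarrow>
    (k, a) \<odot>\<^bsub>V\<^esub> x = sact V k x \<oplus>\<^bsub>V\<^esub> ract V a x"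
  using V.smult_l_distr[of "(k, \<zero>\<^bsub>A\<^esub>)" "(\<zero>\<^bsub>K\<^esub>, a)" x] by (simp add: ract_def sact_def)

lemma ract_zero [simp]: "a \<in> carrier A \<Longrightarrow> ract V a \<zero>\<^bsub>V\<^esub> = \<zero>\<^bsub>V\<^esub>"
  by (rule additive_zero[OF V.abelian_group_axioms V.abelian_group_axioms]) (simp_all add: ract_add)

lemma ract_minus:
  "a \<in> carrier A \<Longrightarrow> x \<in> carrier V \<Longrightarrow> ract V a (\<ominus>\<^bsub>V\<^esub> x) = \<ominus>\<^bsub>V\<^esub> ract V a x"
  by (rule additive_minus[OF V.abelian_group_axioms V.abelian_group_axioms]) (simp_all add: ract_add)

lemma sact_zero [simp]: "k \<in> carrier K \<Longrightarrow> sact V k \<zero>\<^bsub>V\<^esub> = \<zero>\<^bsub>V\<^esub>"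
  by (rule additive_zero[OF V.abelian_group_axioms V.abelian_group_axioms]) (simp_all add: sact_add)

lemma sact_minus:
  "k \<in> carrier K \<Longrightarrow> x \<in> carrier V \<Longrightarrow> sact V k (\<ominus>\<^bsub>V\<^esub> x) = \<ominus>\<^bsub>V\<^esub> sact V k x"
  by (rule additive_minus[OF V.abelian_group_axioms V.abelian_group_axioms]) (simp_all add: sact_add)

lemma ract_minus_left:
  "a \<in> carrier A \<Longrightarrow> x \<in> carrier V \<Longrightarrow> ract V (\<ominus>\<^bsub>A\<^esub> a) x = \<ominus>\<^bsub>V\<^esub> ract V a x"
  by (rule additive_minus[OF M.abelian_group_axioms V.abelian_group_axioms, where h = "\<lambda>a. ract V a x"])
    (simp_all add: ract_add_left)

lemma plus_homs_closed: "\<phi> \<in> plus_homs \<Delta> V \<Longrightarrow> a \<in> carrier A \<Longrightarrow> \<phi> a \<in> carrier V"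
  by (auto simp: plus_homs_def)

lemma plus_homs_add:
  "\<phi> \<in> plus_homs \<Delta> V \<Longrightarrow> a \<in> carrier A \<Longrightarrow> b \<in> carrier A \<Longrightarrow> \<phi> (a \<oplus>\<^bsub>A\<^esub> b) = \<phi> a \<oplus>\<^bsub>V\<^esub> \<phi> b"
  by (simp add: plus_homs_def)

lemma plus_homs_sact:
  "\<phi> \<in> plus_homs \<Delta> V \<Longrightarrow> k \<in> carrier K \<Longrightarrow> a \<in> carrier A \<Longrightarrow> \<phi> (k \<odot>\<^bsub>A\<^esub> a) = sact V k (\<phi> a)"
  by (simp add: plus_homs_def)

lemma plus_homs_ract:
  "\<phi> \<in> plus_homs \<Delta> V \<Longrightarrow> a \<in> carrier A \<Longrightarrow> b \<in> carrier A \<Longrightarrow>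
    ract V a (\<phi> b) = \<phi> (a \<otimes>\<^bsub>A\<^esub> \<Delta> \<otimes>\<^bsub>A\<^esub> b)"
  by (simp add: plus_homs_def)

lemma plus_homs_minus:
  "\<phi> \<in> plus_homs \<Delta> V \<Longrightarrow> a \<in> carrier A \<Longrightarrow> \<phi> (\<ominus>\<^bsub>A\<^esub> a) = \<ominus>\<^bsub>V\<^esub> \<phi> a"
  by (rule additive_minus[OF M.abelian_group_axioms V.abelian_group_axioms])
    (simp_all add: plus_homs_add[of \<phi>] plus_homs_closed[of \<phi>])

lemma plus_homs_zero: "\<phi> \<in> plus_homs \<Delta> V \<Longrightarrow> \<phi> \<zero>\<^bsub>A\<^esub> = \<zero>\<^bsub>V\<^esub>"
  by (rule additive_zero[OF M.abelian_group_axioms V.abelian_group_axioms])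
    (simp_all add: plus_homs_add[of \<phi>] plus_homs_closed[of \<phi>])

lemma plus_homs_eqI:
  assumes "\<phi> \<in> plus_homs \<Delta> V" "\<chi> \<in> plus_homs \<Delta> V" "\<And>a. a \<in> carrier A \<Longrightarrow> \<phi> a = \<chi> a"
  shows "\<phi> = \<chi>"
  using assms by (auto simp: plus_homs_def PiE_def intro: extensionalityI)

lemma plus_homsI:
  assumes "\<And>a. a \<in> carrier A \<Longrightarrow> f a \<in> carrier V"
    and "\<And>a b. a \<in> carrier A \<Longrightarrow> b \<in> carrier A \<Longrightarrow> f (a \<oplus>\<^bsub>A\<^esub> b) = f a \<oplus>\<^bsub>V\<^esub> f b"
    and "\<And>k a. k \<in> carrier K \<Longrightarrow> a \<in> carrier A \<Longrightarrow> f (k \<odot>\<^bsub>A\<^esub> a) = sact V k (f a)"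
    and "\<And>a b. a \<in> carrier A \<Longrightarrow> b \<in> carrier A \<Longrightarrow> f (a \<otimes>\<^bsub>A\<^esub> \<Delta> \<otimes>\<^bsub>A\<^esub> b) = ract V a (f b)"
  shows "restrict f (carrier A) \<in> plus_homs \<Delta> V"
  using assms by (auto simp: plus_homs_def)

text \<open>Right multiplications commute with the left \<open>B\<close>-action on
  \<open>B\<^sup>+\<close>.\<close>

lemma shift_closed: "a \<in> carrier A \<Longrightarrow> \<phi> \<in> plus_homs \<Delta> V \<Longrightarrow> shift a \<phi> \<in> plus_homs \<Delta> V"
  unfolding shift_def
  by (rule plus_homsI)
    (simp_all add: A.l_distr plus_homs_add[of \<phi>] smult_mult_left plus_homs_sact[of \<phi>] plus_homs_ract[of \<phi>]
      plus_homs_closed[of \<phi>] A.m_assoc)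

text \<open>This function is \<open>g x\<close>, the image of \<open>x\<close> under the canonical
  map from \<open>V\<close> to \<open>Hom\<^sub>B(B\<^sup>+, V)\<close>.\<close>

lemma ract_hom: "x \<in> carrier V \<Longrightarrow> (\<lambda>b\<in>carrier A. ract V b x) \<in> plus_homs \<Delta> V"
  by (rule plus_homsI) (simp_all add: ract_add_left sact_ract ract_ract)

lemma plus_homs_pointwise_add:
  "\<phi> \<in> plus_homs \<Delta> V \<Longrightarrow> \<chi> \<in> plus_homs \<Delta> V \<Longrightarrow> (\<lambda>b\<in>carrier A. \<phi> b \<oplus>\<^bsub>V\<^esub> \<chi> b) \<in> plus_homs \<Delta> V"
  by (rule plus_homsI)
    (simp_all add: plus_homs_add[of \<phi>] plus_homs_sact[of \<phi>] plus_homs_ract[of \<phi>, symmetric]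
      plus_homs_add[of \<chi>] plus_homs_sact[of \<chi>] plus_homs_ract[of \<chi>, symmetric]
      plus_homs_closed[of \<phi>] plus_homs_closed[of \<chi>] ract_add sact_add V.a_ac)

lemma plus_homs_pointwise_minus:
  "\<phi> \<in> plus_homs \<Delta> V \<Longrightarrow> (\<lambda>b\<in>carrier A. \<ominus>\<^bsub>V\<^esub> \<phi> b) \<in> plus_homs \<Delta> V"
  by (rule plus_homsI)
    (simp_all add: plus_homs_add[of \<phi>] plus_homs_sact[of \<phi>] plus_homs_ract[of \<phi>, symmetric]
      plus_homs_closed[of \<phi>] ract_minus sact_minus V.minus_add)

text \<open>Scaling by \<open>k\<close> again gives a \<open>K\<close>-linear map because
  \<open>K\<close> is commutative.\<close>

lemma plus_homs_pointwise_sact: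
  "k \<in> carrier K \<Longrightarrow> \<phi> \<in> plus_homs \<Delta> V \<Longrightarrow> (\<lambda>b\<in>carrier A. sact V k (\<phi> b)) \<in> plus_homs \<Delta> V"
  by (rule plus_homsI)
    (simp_all add: plus_homs_add[of \<phi>] plus_homs_sact[of \<phi>] plus_homs_ract[of \<phi>, symmetric]
      plus_homs_closed[of \<phi>] sact_add sact_sact sact_ract ract_sact R.m_comm)

lemma plus_homs_pointwise_zero: "(\<lambda>b\<in>carrier A. \<zero>\<^bsub>V\<^esub>) \<in> plus_homs \<Delta> V"
  by (rule plus_homsI) simp_all

end

section \<open>Consequences of \<open>A \<Delta> A = A\<close>: additive generation and a bound on
  the size of \<open>Hom\<^sub>B(B\<^sup>+, V)\<close>\<close>

lemma (in unital_algebra) homotope_plus_generated_induct: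
  assumes surj: "mult_map_surjective (homotope_plus A \<Delta>)" and "\<Delta> \<in> carrier A" "a \<in> carrier A"
    and zero: "P \<zero>\<^bsub>A\<^esub>"
    and add: "\<And>a b. a \<in> carrier A \<Longrightarrow> b \<in> carrier A \<Longrightarrow> P a \<Longrightarrow> P b \<Longrightarrow> P (a \<oplus>\<^bsub>A\<^esub> b)"
    and mult: "\<And>a b. a \<in> carrier A \<Longrightarrow> b \<in> carrier A \<Longrightarrow> P (a \<otimes>\<^bsub>A\<^esub> \<Delta> \<otimes>\<^bsub>A\<^esub> b)"
  shows "P a"
proof -
  \<comment> \<open>\<open>homotope_plus\<close> alters only \<open>mult\<close>, which
    \<open>finsum\<close> ignores: sums in \<open>A\<^sub>\<Delta>\<close> are sums in
    \<open>A\<close>.\<close>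
  have *: "finsum (homotope_plus A \<Delta>) f S = finsum A f S" for f and S :: "nat set"
    by (simp add: finsum_def finprod_def homotope_plus_def)
  obtain n :: nat and x y where xy: "x \<in> {..<n} \<rightarrow> carrier A" "y \<in> {..<n} \<rightarrow> carrier A"
      "a = (\<Oplus>\<^bsub>A\<^esub>i\<in>{..<n}. x i \<otimes>\<^bsub>A\<^esub> \<Delta> \<otimes>\<^bsub>A\<^esub> y i)"
    using surj \<open>a \<in> carrier A\<close> unfolding mult_map_surjective_def *
    by (auto simp: homotope_plus_def)
  have "(\<Oplus>\<^bsub>A\<^esub>i\<in>S. x i \<otimes>\<^bsub>A\<^esub> \<Delta> \<otimes>\<^bsub>A\<^esub> y i) \<in> carrier A \<and> P (\<Oplus>\<^bsub>A\<^esub>i\<in>S. x i \<otimes>\<^bsub>A\<^esub> \<Delta> \<otimes>\<^bsub>A\<^esub> y i)"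
    if "finite S" "S \<subseteq> {..<n}" for S
    using that
  proof (induction S rule: finite_induct)
    case empty
    show ?case using zero by simp
  next
    case (insert i S)
    have i: "x i \<in> carrier A" "y i \<in> carrier A" using insert.prems xy by auto
    have S: "(\<lambda>i. x i \<otimes>\<^bsub>A\<^esub> \<Delta> \<otimes>\<^bsub>A\<^esub> y i) \<in> S \<rightarrow> carrier A"
      using insert.prems xy \<open>\<Delta> \<in> carrier A\<close> by (auto simp: Pi_iff)
    show ?case
      using insert i S \<open>\<Delta> \<in> carrier A\<close> by (simp add: add mult)
  qed
  then show ?thesis using xy by auto
qed

text \<open>Write \<open>1 = \<Sum> x\<^sub>i \<Delta> y\<^sub>i\<close>; then
  \<open>\<phi> b = \<Sum> (b x\<^sub>i) \<phi>(y\<^sub>i)\<close> by linearity, so the values at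
  the \<open>y\<^sub>i\<close> determine \<open>\<phi>\<close>. The list is chosen before
  \<open>V\<close>, which later permits one encoding for all modules.\<close>

lemma (in unital_algebra) homotope_plus_generators:
  assumes surj: "mult_map_surjective (homotope_plus A \<Delta>)" and \<Delta>: "\<Delta> \<in> carrier A"
  shows "\<exists>ys. \<forall>V. left_module (homotope K A \<Delta>) V \<longrightarrow> inj_on (\<lambda>\<phi>. map \<phi> ys) (plus_homs \<Delta> V)"
proof -
  have *: "finsum (homotope_plus A \<Delta>) f S = finsum A f S" for f and S :: "nat set"
    by (simp add: finsum_def finprod_def homotope_plus_def)
  obtain n :: nat and x y where xy: "x \<in> {..<n} \<rightarrow> carrier A" "y \<in> {..<n} \<rightarrow> carrier A"
      "\<one>\<^bsub>A\<^esub> = (\<Oplus>\<^bsub>A\<^esub>i\<in>{..<n}. x i \<otimes>\<^bsub>A\<^esub> \<Delta> \<otimes>\<^bsub>A\<^esub> y i)"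
    using bspec[OF surj[unfolded mult_map_surjective_def *], of "\<one>\<^bsub>A\<^esub>"]
    by (auto simp: homotope_plus_def)
  have xy' [simp]: "x i \<in> carrier A" "y i \<in> carrier A" if "i < n" for i
    using xy that by auto
  have t: "(\<lambda>i. x i \<otimes>\<^bsub>A\<^esub> \<Delta> \<otimes>\<^bsub>A\<^esub> y i) \<in> {..<n} \<rightarrow> carrier A" using \<Delta> by auto
  show ?thesis
  proof (intro exI allI impI inj_onI)
    fix V \<phi> \<chi>
    assume V: "left_module (homotope K A \<Delta>) V" and \<phi>: "\<phi> \<in> plus_homs \<Delta> V" and \<chi>: "\<chi> \<in> plus_homs \<Delta> V"
      and eq: "map \<phi> (map y [0..<n]) = map \<chi> (map y [0..<n])"
    interpret V: left_module "homotope K A \<Delta>" V by fact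
    interpret homotope_module K A \<Delta> V by unfold_locales (rule \<Delta>)
    have expand: "\<psi> b = (\<Oplus>\<^bsub>V\<^esub>i\<in>{..<n}. ract V (b \<otimes>\<^bsub>A\<^esub> x i) (\<psi> (y i)))"
      if \<psi>: "\<psi> \<in> plus_homs \<Delta> V" and b: "b \<in> carrier A" for \<psi> b
    proof -
      have "\<psi> (b \<otimes>\<^bsub>A\<^esub> (\<Oplus>\<^bsub>A\<^esub>i\<in>{..<n}. x i \<otimes>\<^bsub>A\<^esub> \<Delta> \<otimes>\<^bsub>A\<^esub> y i)) =
          (\<Oplus>\<^bsub>V\<^esub>i\<in>{..<n}. \<psi> (b \<otimes>\<^bsub>A\<^esub> (x i \<otimes>\<^bsub>A\<^esub> \<Delta> \<otimes>\<^bsub>A\<^esub> y i)))"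
        by (rule additive_finsum[OF M.abelian_group_axioms V.abelian_group_axioms _ _ _ t, of "\<lambda>a. \<psi> (b \<otimes>\<^bsub>A\<^esub> a)"])
          (simp_all add: b plus_homs_closed[OF \<psi>] A.r_distr plus_homs_add[OF \<psi>])
      also have "\<dots> = (\<Oplus>\<^bsub>V\<^esub>i\<in>{..<n}. ract V (b \<otimes>\<^bsub>A\<^esub> x i) (\<psi> (y i)))"
        by (rule V.finsum_cong')
          (auto simp: b \<Delta> plus_homs_closed[OF \<psi>] plus_homs_ract[OF \<psi>] A.m_assoc)
      finally show ?thesis using b by (simp add: xy(3)[symmetric])
    qed
    show "\<phi> = \<chi>"
    proof (rule plus_homs_eqI[OF \<phi> \<chi>])
      fix b assume b: "b \<in> carrier A"
      have "\<phi> (y i) = \<chi> (y i)" if "i < n" for i using eq that by simp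
      then show "\<phi> b = \<chi> b"
        unfolding expand[OF \<phi> b] expand[OF \<chi> b]
        by (intro V.finsum_cong') (auto simp: b plus_homs_closed[OF \<chi>])
    qed
  qed
qed

text \<open>Lists are folded through an injective pairing of the infinite type. Injectivity is
  claimed only length by length, since \<open>[]\<close> goes to an arbitrary value that may also be
  the code of a longer list.\<close>

lemma infinite_encode_lists:
  assumes "infinite (UNIV :: 'u set)"
  shows "\<exists>e :: 'u list \<Rightarrow> 'u. \<forall>n. inj_on e {xs. length xs = n}"
proof -
  obtain p :: "'u \<times> 'u \<Rightarrow> 'u" where p: "inj p"
    using card_of_Times_same_infinite[OF assms] card_of_ordIso[of "UNIV \<times> UNIV :: ('u \<times> 'u) set" "UNIV :: 'u set"]
    by (auto simp: bij_betw_def)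
  define e where "e xs = foldr (\<lambda>x y. p (x, y)) xs undefined" for xs
  have "xs = ys" if "length xs = length ys" "e xs = e ys" for xs ys
    using that
    by (induction xs ys rule: list_induct2) (auto simp: e_def dest: injD[OF p])
  then have "inj_on e {xs. length xs = n}" for n by (auto simp: inj_on_def)
  then show ?thesis by blast
qed

section \<open>The construction on modules\<close>

locale homotope_equivalence = unital_algebra K A
  for K :: "('k, 'e) ring_scheme" (structure) and A :: "('k, 'a, 'f) module_scheme" (structure) +
  fixes \<Delta> \<Delta>' c d u v h\<^sub>1 h\<^sub>2
  assumes closed [simp]: "\<Delta> \<in> carrier A" "\<Delta>' \<in> carrier A" "c \<in> carrier A" "d \<in> carrier A"
      "u \<in> carrier A" "v \<in> carrier A" "h\<^sub>1 \<in> carrier A" "h\<^sub>2 \<in> carrier A"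
    and c_Delta: "c \<otimes>\<^bsub>A\<^esub> \<Delta> = \<Delta>' \<otimes>\<^bsub>A\<^esub> d"
    and u_Delta': "u \<otimes>\<^bsub>A\<^esub> \<Delta>' = \<Delta> \<otimes>\<^bsub>A\<^esub> v"
    and c_u: "c \<otimes>\<^bsub>A\<^esub> u = \<one>\<^bsub>A\<^esub> \<oplus>\<^bsub>A\<^esub> \<Delta>' \<otimes>\<^bsub>A\<^esub> h\<^sub>1"
    and d_v: "d \<otimes>\<^bsub>A\<^esub> v = \<one>\<^bsub>A\<^esub> \<oplus>\<^bsub>A\<^esub> h\<^sub>1 \<otimes>\<^bsub>A\<^esub> \<Delta>'"
    and u_c: "u \<otimes>\<^bsub>A\<^esub> c = \<one>\<^bsub>A\<^esub> \<oplus>\<^bsub>A\<^esub> \<Delta> \<otimes>\<^bsub>A\<^esub> h\<^sub>2"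
    and v_d: "v \<otimes>\<^bsub>A\<^esub> d = \<one>\<^bsub>A\<^esub> \<oplus>\<^bsub>A\<^esub> h\<^sub>2 \<otimes>\<^bsub>A\<^esub> \<Delta>"
    and surj: "mult_map_surjective (homotope_plus A \<Delta>)"
    and surj': "mult_map_surjective (homotope_plus A \<Delta>')"
begin

text \<open>The hypotheses also hold without the signs, but it is the construction with the signs that is
  inverse to the original one, by \<open>unit_map\<close> below.\<close>

lemma swapped:
  "homotope_equivalence K A \<Delta>' \<Delta> (\<ominus>\<^bsub>A\<^esub> u) (\<ominus>\<^bsub>A\<^esub> v) (\<ominus>\<^bsub>A\<^esub> c) (\<ominus>\<^bsub>A\<^esub> d) h\<^sub>2 h\<^sub>1"
  by unfold_locales
    (simp_all add: A.l_minus A.r_minus c_Delta u_Delta' c_u d_v u_c v_d surj surj')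

text \<open>This and the next two identities come from bracketing the triple products
  \<open>v d v\<close>, \<open>d v d\<close> and \<open>c u c\<close> in both ways and cancelling.
  The present one puts the image of \<open>inn\<close> inside the kernel that defines
  \<open>glue\<close>.\<close>

lemma v_h1_Delta': "v \<otimes>\<^bsub>A\<^esub> (h\<^sub>1 \<otimes>\<^bsub>A\<^esub> \<Delta>') = h\<^sub>2 \<otimes>\<^bsub>A\<^esub> (\<Delta> \<otimes>\<^bsub>A\<^esub> v)"
proof -
  have "v \<oplus>\<^bsub>A\<^esub> v \<otimes>\<^bsub>A\<^esub> (h\<^sub>1 \<otimes>\<^bsub>A\<^esub> \<Delta>') = v \<otimes>\<^bsub>A\<^esub> (d \<otimes>\<^bsub>A\<^esub> v)" by (simp add: d_v A.r_distr)
  also have "\<dots> = v \<oplus>\<^bsub>A\<^esub> h\<^sub>2 \<otimes>\<^bsub>A\<^esub> (\<Delta> \<otimes>\<^bsub>A\<^esub> v)"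
    by (simp add: A.m_assoc[symmetric] v_d A.l_distr)
  finally show ?thesis by simp
qed

lemma h1_Delta'_d: "h\<^sub>1 \<otimes>\<^bsub>A\<^esub> (\<Delta>' \<otimes>\<^bsub>A\<^esub> d) = d \<otimes>\<^bsub>A\<^esub> (h\<^sub>2 \<otimes>\<^bsub>A\<^esub> \<Delta>)"
proof -
  have "d \<oplus>\<^bsub>A\<^esub> h\<^sub>1 \<otimes>\<^bsub>A\<^esub> (\<Delta>' \<otimes>\<^bsub>A\<^esub> d) = d \<otimes>\<^bsub>A\<^esub> v \<otimes>\<^bsub>A\<^esub> d"
    by (simp add: d_v A.l_distr A.m_assoc)
  also have "\<dots> = d \<oplus>\<^bsub>A\<^esub> d \<otimes>\<^bsub>A\<^esub> (h\<^sub>2 \<otimes>\<^bsub>A\<^esub> \<Delta>)"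
    by (simp add: A.m_assoc v_d A.r_distr)
  finally show ?thesis by simp
qed

lemma Delta'_h1_c: "\<Delta>' \<otimes>\<^bsub>A\<^esub> (h\<^sub>1 \<otimes>\<^bsub>A\<^esub> c) = c \<otimes>\<^bsub>A\<^esub> (\<Delta> \<otimes>\<^bsub>A\<^esub> h\<^sub>2)"
proof -
  have "c \<oplus>\<^bsub>A\<^esub> \<Delta>' \<otimes>\<^bsub>A\<^esub> (h\<^sub>1 \<otimes>\<^bsub>A\<^esub> c) = c \<otimes>\<^bsub>A\<^esub> u \<otimes>\<^bsub>A\<^esub> c"
    by (simp add: c_u A.l_distr A.m_assoc)
  also have "\<dots> = c \<oplus>\<^bsub>A\<^esub> c \<otimes>\<^bsub>A\<^esub> (\<Delta> \<otimes>\<^bsub>A\<^esub> h\<^sub>2)"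
    by (simp add: A.m_assoc u_c A.r_distr)
  finally show ?thesis by simp
qed

text \<open>Both sides equal \<open>c u \<Delta>'\<close>.\<close>

lemma c_Delta_v: "c \<otimes>\<^bsub>A\<^esub> (\<Delta> \<otimes>\<^bsub>A\<^esub> v) = \<Delta>' \<oplus>\<^bsub>A\<^esub> \<Delta>' \<otimes>\<^bsub>A\<^esub> (h\<^sub>1 \<otimes>\<^bsub>A\<^esub> \<Delta>')"
  by (simp add: u_Delta'[symmetric] A.m_assoc[symmetric] c_u A.l_distr)

text \<open>Write \<open>W\<close> for \<open>plus_homs \<Delta> V\<close>. The elements of \<open>glue V\<close> are the pairs \<open>(x, \<phi>) \<in> V \<oplus> W\<close> with
  \<open>h\<^sub>2 g x + v \<phi> = 0\<close>, where \<open>g x\<close> is \<open>b \<mapsto> b x\<close>; \<open>inn\<close> and \<open>out\<close> are the maps \<open>W \<rightarrow> glue V \<rightarrow> W\<close> whose composite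
  is \<open>\<Delta>'\<close>, and \<open>a \<in> A\<close>, as an element of the homotope of \<open>\<Delta>'\<close>, acts on \<open>glue V\<close> by \<open>inn \<circ> a \<circ> out\<close>.\<close>

definition out where
  "out V z = (\<lambda>b\<in>carrier A. ract V (b \<otimes>\<^bsub>A\<^esub> c) (fst z) \<oplus>\<^bsub>V\<^esub> snd z (b \<otimes>\<^bsub>A\<^esub> \<Delta>'))"

text \<open>The column \<open>(v, - h\<^sub>1 \<Delta>')\<close> is the first column of the inverse
  of \<open>T\<close>: by \<open>d_v\<close> and \<open>v_h1_Delta'\<close>, \<open>T\<close> maps
  it to \<open>(1, 0)\<close>. Likewise \<open>out\<close> is the first row of
  \<open>S (g \<oplus> 1)\<close>, and the second row is the equation that cuts out
  \<open>glue V\<close>.\<close>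

definition inn where
  "inn V \<phi> = (\<phi> v, \<lambda>b\<in>carrier A. \<ominus>\<^bsub>V\<^esub> \<phi> (b \<otimes>\<^bsub>A\<^esub> (h\<^sub>1 \<otimes>\<^bsub>A\<^esub> \<Delta>')))"

definition glue_add where
  "glue_add V z z' = (fst z \<oplus>\<^bsub>V\<^esub> fst z', \<lambda>b\<in>carrier A. snd z b \<oplus>\<^bsub>V\<^esub> snd z' b)"

definition glue_sact where
  "glue_sact V k z = (sact V k (fst z), \<lambda>b\<in>carrier A. sact V k (snd z b))"

definition glue_ract where
  "glue_ract V a z = inn V (shift a (out V z))"

definition glue :: "('k \<times> 'a, 'w, 'g) module_scheme \<Rightarrow> ('k \<times> 'a, 'w \<times> ('a \<Rightarrow> 'w)) module" where
  "glue V = \<lparr>carrier = {z. fst z \<in> carrier V \<and> snd z \<in> plus_homs \<Delta> V \<and>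
       (\<forall>a\<in>carrier A. ract V (a \<otimes>\<^bsub>A\<^esub> h\<^sub>2) (fst z) \<oplus>\<^bsub>V\<^esub> snd z (a \<otimes>\<^bsub>A\<^esub> v) = \<zero>\<^bsub>V\<^esub>)},
     mult = undefined, one = undefined, zero = (\<zero>\<^bsub>V\<^esub>, \<lambda>b\<in>carrier A. \<zero>\<^bsub>V\<^esub>),
     add = glue_add V, smult = (\<lambda>(k, a) z. glue_add V (glue_sact V k z) (glue_ract V a z))\<rparr>"

definition glue_map where
  "glue_map h z = (h (fst z), \<lambda>b\<in>carrier A. h (snd z b))"

end

locale homotope_equivalence_module =
  homotope_equivalence K A \<Delta> \<Delta>' c d u v h\<^sub>1 h\<^sub>2 + V: left_module "homotope K A \<Delta>" V
  for K (structure) and A (structure) and \<Delta> \<Delta>' c d u v h\<^sub>1 h\<^sub>2 and V (structure)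

sublocale homotope_equivalence_module \<subseteq> homotope_module K A \<Delta> V
  by unfold_locales simp

context homotope_equivalence_module
begin

section \<open>The glued module over the homotope of \<open>\<Delta>'\<close>\<close>

lemma glue_carrierD:
  assumes "z \<in> carrier (glue V)"
  shows "fst z \<in> carrier V" "snd z \<in> plus_homs \<Delta> V"
    and "a \<in> carrier A \<Longrightarrow> ract V (a \<otimes>\<^bsub>A\<^esub> h\<^sub>2) (fst z) \<oplus>\<^bsub>V\<^esub> snd z (a \<otimes>\<^bsub>A\<^esub> v) = \<zero>\<^bsub>V\<^esub>"
  using assms by (auto simp: glue_def)

lemma glue_carrierI:
  assumes "x \<in> carrier V" "\<phi> \<in> plus_homs \<Delta> V"
    and "\<And>a. a \<in> carrier A \<Longrightarrow> ract V (a \<otimes>\<^bsub>A\<^esub> h\<^sub>2) x \<oplus>\<^bsub>V\<^esub> \<phi> (a \<otimes>\<^bsub>A\<^esub> v) = \<zero>\<^bsub>V\<^esub>"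
  shows "(x, \<phi>) \<in> carrier (glue V)"
  using assms by (auto simp: glue_def)

lemma glue_add_eq: "z \<oplus>\<^bsub>glue V\<^esub> z' = glue_add V z z'"
  and glue_zero_eq: "\<zero>\<^bsub>glue V\<^esub> = (\<zero>\<^bsub>V\<^esub>, \<lambda>b\<in>carrier A. \<zero>\<^bsub>V\<^esub>)"
  and glue_smult_eq: "(k, a) \<odot>\<^bsub>glue V\<^esub> z = glue_add V (glue_sact V k z) (glue_ract V a z)"
  by (simp_all add: glue_def)

lemma out_closed:
  assumes "z \<in> carrier (glue V)"
  shows "out V z \<in> plus_homs \<Delta> V"
proof -
  note z = glue_carrierD[OF assms]
  have "(\<lambda>b\<in>carrier A. shift c (\<lambda>b\<in>carrier A. ract V b (fst z)) b \<oplus>\<^bsub>V\<^esub> shift \<Delta>' (snd z) b) \<in> plus_homs \<Delta> V"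
    by (intro plus_homs_pointwise_add shift_closed ract_hom z) simp_all
  also have "(\<lambda>b\<in>carrier A. shift c (\<lambda>b\<in>carrier A. ract V b (fst z)) b \<oplus>\<^bsub>V\<^esub> shift \<Delta>' (snd z) b) = out V z"
    by (auto simp: out_def shift_def)
  finally show ?thesis .
qed

text \<open>The kernel condition amounts to
  \<open>h\<^sub>2 \<Delta> v = v h\<^sub>1 \<Delta>'\<close>, which is
  \<open>v_h1_Delta'\<close>.\<close>

lemma inn_closed:
  assumes \<phi>: "\<phi> \<in> plus_homs \<Delta> V"
  shows "inn V \<phi> \<in> carrier (glue V)"
  unfolding inn_def
proof (rule glue_carrierI)
  show "\<phi> v \<in> carrier V" using \<phi> by (simp add: plus_homs_closed)
  have "(\<lambda>b\<in>carrier A. \<ominus>\<^bsub>V\<^esub> shift (h\<^sub>1 \<otimes>\<^bsub>A\<^esub> \<Delta>') \<phi> b) \<in> plus_homs \<Delta> V"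
    by (intro plus_homs_pointwise_minus shift_closed \<phi>) simp
  also have "(\<lambda>b\<in>carrier A. \<ominus>\<^bsub>V\<^esub> shift (h\<^sub>1 \<otimes>\<^bsub>A\<^esub> \<Delta>') \<phi> b) = (\<lambda>b\<in>carrier A. \<ominus>\<^bsub>V\<^esub> \<phi> (b \<otimes>\<^bsub>A\<^esub> (h\<^sub>1 \<otimes>\<^bsub>A\<^esub> \<Delta>')))"
    by (auto simp: shift_def)
  finally show "(\<lambda>b\<in>carrier A. \<ominus>\<^bsub>V\<^esub> \<phi> (b \<otimes>\<^bsub>A\<^esub> (h\<^sub>1 \<otimes>\<^bsub>A\<^esub> \<Delta>'))) \<in> plus_homs \<Delta> V" .
qed (simp add: plus_homs_ract[OF \<phi>] plus_homs_closed[OF \<phi>] A.m_assoc v_h1_Delta' V.r_neg)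

text \<open>By \<open>c_Delta_v\<close> the first coordinate contributes
  \<open>\<Delta>' + \<Delta>' h\<^sub>1 \<Delta>'\<close>, and the second cancels the
  surplus.\<close>

lemma out_inn:
  assumes \<phi>: "\<phi> \<in> plus_homs \<Delta> V"
  shows "out V (inn V \<phi>) = shift \<Delta>' \<phi>"
  unfolding out_def shift_def
proof (rule restrict_ext)
  fix b assume b: "b \<in> carrier A"
  have "ract V (b \<otimes>\<^bsub>A\<^esub> c) (\<phi> v) = \<phi> (b \<otimes>\<^bsub>A\<^esub> \<Delta>' \<oplus>\<^bsub>A\<^esub> b \<otimes>\<^bsub>A\<^esub> (\<Delta>' \<otimes>\<^bsub>A\<^esub> (h\<^sub>1 \<otimes>\<^bsub>A\<^esub> \<Delta>')))"
    using b by (simp add: plus_homs_ract[OF \<phi>] A.m_assoc c_Delta_v A.r_distr)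
  then show "ract V (b \<otimes>\<^bsub>A\<^esub> c) (fst (inn V \<phi>)) \<oplus>\<^bsub>V\<^esub> snd (inn V \<phi>) (b \<otimes>\<^bsub>A\<^esub> \<Delta>') = \<phi> (b \<otimes>\<^bsub>A\<^esub> \<Delta>')"
    using b by (simp add: inn_def plus_homs_add[OF \<phi>] plus_homs_closed[OF \<phi>] A.m_assoc V.a_assoc V.r_neg)
qed

lemma shift_shift: "a \<in> carrier A \<Longrightarrow> b \<in> carrier A \<Longrightarrow> shift a (shift b \<phi>) = shift (a \<otimes>\<^bsub>A\<^esub> b) \<phi>"
  by (auto simp: shift_def A.m_assoc)

lemma glue_ract_closed:
  "a \<in> carrier A \<Longrightarrow> z \<in> carrier (glue V) \<Longrightarrow> glue_ract V a z \<in> carrier (glue V)"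
  unfolding glue_ract_def by (intro inn_closed shift_closed out_closed)

text \<open>The inner \<open>out \<circ> inn\<close> is \<open>\<Delta>'\<close> by
  \<open>out_inn\<close>; this is where the multiplication of the second homotope arises.\<close>

lemma glue_ract_glue_ract:
  assumes "a \<in> carrier A" "b \<in> carrier A" "z \<in> carrier (glue V)"
  shows "glue_ract V a (glue_ract V b z) = glue_ract V (a \<otimes>\<^bsub>A\<^esub> \<Delta>' \<otimes>\<^bsub>A\<^esub> b) z"
  using assms by (simp add: glue_ract_def out_inn shift_closed out_closed shift_shift A.m_assoc)

lemma glue_add_closed:
  assumes "z \<in> carrier (glue V)" "z' \<in> carrier (glue V)"
  shows "glue_add V z z' \<in> carrier (glue V)"
  unfolding glue_add_def
proof (rule glue_carrierI)
  note z = glue_carrierD[OF assms(1)] glue_carrierD[OF assms(2)]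
  show "fst z \<oplus>\<^bsub>V\<^esub> fst z' \<in> carrier V" using z by simp
  show "(\<lambda>b\<in>carrier A. snd z b \<oplus>\<^bsub>V\<^esub> snd z' b) \<in> plus_homs \<Delta> V"
    by (intro plus_homs_pointwise_add z)
  fix a assume a: "a \<in> carrier A"
  have "ract V (a \<otimes>\<^bsub>A\<^esub> h\<^sub>2) (fst z \<oplus>\<^bsub>V\<^esub> fst z') \<oplus>\<^bsub>V\<^esub> (snd z (a \<otimes>\<^bsub>A\<^esub> v) \<oplus>\<^bsub>V\<^esub> snd z' (a \<otimes>\<^bsub>A\<^esub> v)) =
      (ract V (a \<otimes>\<^bsub>A\<^esub> h\<^sub>2) (fst z) \<oplus>\<^bsub>V\<^esub> snd z (a \<otimes>\<^bsub>A\<^esub> v)) \<oplus>\<^bsub>V\<^esub>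
      (ract V (a \<otimes>\<^bsub>A\<^esub> h\<^sub>2) (fst z') \<oplus>\<^bsub>V\<^esub> snd z' (a \<otimes>\<^bsub>A\<^esub> v))"
    using z a by (simp add: ract_add plus_homs_closed[OF z(2)] plus_homs_closed[OF z(5)] V.a_ac)
  also have "\<dots> = \<zero>\<^bsub>V\<^esub>" using z a by simp
  finally show "ract V (a \<otimes>\<^bsub>A\<^esub> h\<^sub>2) (fst z \<oplus>\<^bsub>V\<^esub> fst z') \<oplus>\<^bsub>V\<^esub>
      (\<lambda>b\<in>carrier A. snd z b \<oplus>\<^bsub>V\<^esub> snd z' b) (a \<otimes>\<^bsub>A\<^esub> v) = \<zero>\<^bsub>V\<^esub>"
    using a by simp
qed

lemma glue_sact_closed:
  assumes "k \<in> carrier K" "z \<in> carrier (glue V)"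
  shows "glue_sact V k z \<in> carrier (glue V)"
  unfolding glue_sact_def
proof (rule glue_carrierI)
  note z = glue_carrierD[OF assms(2)]
  show "sact V k (fst z) \<in> carrier V" using z assms by simp
  show "(\<lambda>b\<in>carrier A. sact V k (snd z b)) \<in> plus_homs \<Delta> V"
    by (intro plus_homs_pointwise_sact z assms)
  fix a assume a: "a \<in> carrier A"
  have "ract V (a \<otimes>\<^bsub>A\<^esub> h\<^sub>2) (sact V k (fst z)) \<oplus>\<^bsub>V\<^esub> sact V k (snd z (a \<otimes>\<^bsub>A\<^esub> v)) =
      sact V k (ract V (a \<otimes>\<^bsub>A\<^esub> h\<^sub>2) (fst z) \<oplus>\<^bsub>V\<^esub> snd z (a \<otimes>\<^bsub>A\<^esub> v))"
    using z(1) a assms(1) by (simp add: sact_add plus_homs_closed[OF z(2)] sact_ract ract_sact)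
  also have "\<dots> = \<zero>\<^bsub>V\<^esub>" using z a assms by simp
  finally show "ract V (a \<otimes>\<^bsub>A\<^esub> h\<^sub>2) (sact V k (fst z)) \<oplus>\<^bsub>V\<^esub>
      (\<lambda>b\<in>carrier A. sact V k (snd z b)) (a \<otimes>\<^bsub>A\<^esub> v) = \<zero>\<^bsub>V\<^esub>"
    using a by simp
qed

text \<open>Explicit coordinates of \<open>inn \<circ> a \<circ> out\<close>, from which additivity
  and compatibility with \<open>K\<close> are read off below.\<close>

lemma glue_ract_eq:
  assumes "a \<in> carrier A" "z \<in> carrier (glue V)"
  shows "glue_ract V a z = (ract V (v \<otimes>\<^bsub>A\<^esub> (a \<otimes>\<^bsub>A\<^esub> c)) (fst z) \<oplus>\<^bsub>V\<^esub> snd z (v \<otimes>\<^bsub>A\<^esub> (a \<otimes>\<^bsub>A\<^esub> \<Delta>')),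
    \<lambda>b\<in>carrier A. \<ominus>\<^bsub>V\<^esub> (ract V (b \<otimes>\<^bsub>A\<^esub> (h\<^sub>1 \<otimes>\<^bsub>A\<^esub> (\<Delta>' \<otimes>\<^bsub>A\<^esub> (a \<otimes>\<^bsub>A\<^esub> c)))) (fst z) \<oplus>\<^bsub>V\<^esub>
      snd z (b \<otimes>\<^bsub>A\<^esub> (h\<^sub>1 \<otimes>\<^bsub>A\<^esub> (\<Delta>' \<otimes>\<^bsub>A\<^esub> (a \<otimes>\<^bsub>A\<^esub> \<Delta>'))))))"
  using assms by (auto simp: glue_ract_def inn_def shift_def out_def A.m_assoc intro!: restrict_ext)

lemma glue_eqI:
  assumes "z \<in> carrier (glue V)" "z' \<in> carrier (glue V)" "fst z = fst z'"
    and "\<And>b. b \<in> carrier A \<Longrightarrow> snd z b = snd z' b"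
  shows "z = z'"
  by (rule prod_eqI)
    (use assms glue_carrierD[OF assms(1)] glue_carrierD[OF assms(2)] in \<open>auto intro: plus_homs_eqI\<close>)

lemma abelian_group_glue: "abelian_group (glue V)"
proof (rule abelian_groupI)
  show "\<zero>\<^bsub>glue V\<^esub> \<in> carrier (glue V)"
    unfolding glue_zero_eq by (rule glue_carrierI) (simp_all add: plus_homs_pointwise_zero)
  fix x y z assume x: "x \<in> carrier (glue V)" and y: "y \<in> carrier (glue V)" and z: "z \<in> carrier (glue V)"
  note x' = glue_carrierD[OF x] and y' = glue_carrierD[OF y] and z' = glue_carrierD[OF z]
  note [simp] = plus_homs_closed[OF x'(2)] plus_homs_closed[OF y'(2)] plus_homs_closed[OF z'(2)] x' y' z'
  show "x \<oplus>\<^bsub>glue V\<^esub> y \<in> carrier (glue V)" using x y by (simp add: glue_add_eq glue_add_closed)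
  show "x \<oplus>\<^bsub>glue V\<^esub> y \<oplus>\<^bsub>glue V\<^esub> z = x \<oplus>\<^bsub>glue V\<^esub> (y \<oplus>\<^bsub>glue V\<^esub> z)"
    by (auto simp: glue_add_eq glue_add_def V.a_assoc intro!: restrict_ext)
  show "x \<oplus>\<^bsub>glue V\<^esub> y = y \<oplus>\<^bsub>glue V\<^esub> x"
    by (auto simp: glue_add_eq glue_add_def V.a_comm intro!: restrict_ext)
next
  fix x assume x: "x \<in> carrier (glue V)"
  note x' = glue_carrierD[OF x]
  note [simp] = plus_homs_closed[OF x'(2)] x'
  have z: "\<zero>\<^bsub>glue V\<^esub> \<in> carrier (glue V)"
    unfolding glue_zero_eq by (rule glue_carrierI) (simp_all add: plus_homs_pointwise_zero)
  show "\<zero>\<^bsub>glue V\<^esub> \<oplus>\<^bsub>glue V\<^esub> x = x"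
    unfolding glue_add_eq
    by (rule glue_eqI[OF glue_add_closed[OF z x] x]) (simp_all add: glue_add_def glue_zero_eq)
  let ?y = "(\<ominus>\<^bsub>V\<^esub> fst x, \<lambda>b\<in>carrier A. \<ominus>\<^bsub>V\<^esub> snd x b)"
  have "?y \<in> carrier (glue V)"
  proof (rule glue_carrierI)
    fix a assume a: "a \<in> carrier A"
    have "\<ominus>\<^bsub>V\<^esub> (ract V (a \<otimes>\<^bsub>A\<^esub> h\<^sub>2) (fst x) \<oplus>\<^bsub>V\<^esub> snd x (a \<otimes>\<^bsub>A\<^esub> v)) = \<zero>\<^bsub>V\<^esub>" using a by simp
    then show "ract V (a \<otimes>\<^bsub>A\<^esub> h\<^sub>2) (\<ominus>\<^bsub>V\<^esub> fst x) \<oplus>\<^bsub>V\<^esub> (\<lambda>b\<in>carrier A. \<ominus>\<^bsub>V\<^esub> snd x b) (a \<otimes>\<^bsub>A\<^esub> v) = \<zero>\<^bsub>V\<^esub>"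
      using a by (simp add: ract_minus V.minus_add del: x'(3))
  qed (simp_all add: plus_homs_pointwise_minus)
  moreover have "?y \<oplus>\<^bsub>glue V\<^esub> x = \<zero>\<^bsub>glue V\<^esub>"
    by (auto simp: glue_add_eq glue_add_def glue_zero_eq V.l_neg intro!: restrict_ext)
  ultimately show "\<exists>y\<in>carrier (glue V). y \<oplus>\<^bsub>glue V\<^esub> x = \<zero>\<^bsub>glue V\<^esub>" by blast
qed

lemma left_module_glue: "left_module (homotope K A \<Delta>') (glue V)"
  and glue_sact: "\<And>k z. k \<in> carrier K \<Longrightarrow> z \<in> carrier (glue V) \<Longrightarrow> sact (glue V) k z = glue_sact V k z"
  and glue_ract: "\<And>a z. a \<in> carrier A \<Longrightarrow> z \<in> carrier (glue V) \<Longrightarrow> ract (glue V) a z = glue_ract V a z"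
proof -
  have 1: "glue_sact V (k \<oplus>\<^bsub>K\<^esub> l) z = glue_sact V k z \<oplus>\<^bsub>glue V\<^esub> glue_sact V l z"
    "glue_sact V (k \<otimes>\<^bsub>K\<^esub> l) z = glue_sact V k (glue_sact V l z)"
    "glue_sact V k (z \<oplus>\<^bsub>glue V\<^esub> z') = glue_sact V k z \<oplus>\<^bsub>glue V\<^esub> glue_sact V k z'"
    if k: "k \<in> carrier K" "l \<in> carrier K" and z: "z \<in> carrier (glue V)" "z' \<in> carrier (glue V)" for k l z z'
  proof -
    note z' = glue_carrierD[OF z(1)] glue_carrierD[OF z(2)]
    note [simp] = plus_homs_closed[OF z'(2)] plus_homs_closed[OF z'(5)] z'
    show "glue_sact V (k \<oplus>\<^bsub>K\<^esub> l) z = glue_sact V k z \<oplus>\<^bsub>glue V\<^esub> glue_sact V l z"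
      "glue_sact V (k \<otimes>\<^bsub>K\<^esub> l) z = glue_sact V k (glue_sact V l z)"
      "glue_sact V k (z \<oplus>\<^bsub>glue V\<^esub> z') = glue_sact V k z \<oplus>\<^bsub>glue V\<^esub> glue_sact V k z'"
      using k by (auto simp: glue_sact_def glue_add_eq glue_add_def sact_add_left sact_sact sact_add intro!: restrict_ext)
  qed
  have 2: "glue_sact V \<one>\<^bsub>K\<^esub> z = z" if z: "z \<in> carrier (glue V)" for z
  proof (rule glue_eqI[OF glue_sact_closed[OF _ z] z])
    note z' = glue_carrierD[OF z]
    note [simp] = plus_homs_closed[OF z'(2)] z'
    show "fst (glue_sact V \<one>\<^bsub>K\<^esub> z) = fst z" by (simp add: glue_sact_def)
    show "snd (glue_sact V \<one>\<^bsub>K\<^esub> z) b = snd z b" if "b \<in> carrier A" for b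
      using that by (simp add: glue_sact_def)
  qed simp
  have 3: "glue_ract V (a \<oplus>\<^bsub>A\<^esub> b) z = glue_ract V a z \<oplus>\<^bsub>glue V\<^esub> glue_ract V b z"
    "glue_ract V a (z \<oplus>\<^bsub>glue V\<^esub> z') = glue_ract V a z \<oplus>\<^bsub>glue V\<^esub> glue_ract V a z'"
    if k: "a \<in> carrier A" "b \<in> carrier A" and z: "z \<in> carrier (glue V)" "z' \<in> carrier (glue V)" for a b z z'
  proof -
    note z' = glue_carrierD[OF z(1)] glue_carrierD[OF z(2)]
    note [simp] = plus_homs_closed[OF z'(2)] plus_homs_closed[OF z'(5)] z'(1,4)
      plus_homs_add[OF z'(2)] plus_homs_add[OF z'(5)] A.l_distr A.r_distr ract_add ract_add_left V.minus_add
    show "glue_ract V (a \<oplus>\<^bsub>A\<^esub> b) z = glue_ract V a z \<oplus>\<^bsub>glue V\<^esub> glue_ract V b z"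
      unfolding glue_add_eq using k z
      by (intro glue_eqI glue_add_closed glue_ract_closed) (simp_all add: glue_ract_eq glue_add_def V.a_ac)
    \<comment> \<open>Two passes: \<open>glue_add V z z'\<close> stays folded until
      \<open>glue_ract_eq\<close> has recognised it as an element of \<open>glue V\<close>.\<close>
    show "glue_ract V a (z \<oplus>\<^bsub>glue V\<^esub> z') = glue_ract V a z \<oplus>\<^bsub>glue V\<^esub> glue_ract V a z'"
      unfolding glue_add_eq using k z
      by (intro glue_eqI glue_add_closed glue_ract_closed)
        (simp_all add: glue_ract_eq glue_add_closed, simp_all add: glue_add_def V.a_ac)
  qed
  have 4: "glue_sact V k (glue_ract V a z) = glue_ract V (k \<odot>\<^bsub>A\<^esub> a) z"
    "glue_ract V a (glue_sact V k z) = glue_ract V (k \<odot>\<^bsub>A\<^esub> a) z"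
    if k: "k \<in> carrier K" "a \<in> carrier A" and z: "z \<in> carrier (glue V)" for k a z
  proof -
    note z' = glue_carrierD[OF z]
    note [simp] = plus_homs_closed[OF z'(2)] z'(1)
      plus_homs_sact[OF z'(2)] smult_mult_left smult_mult_right sact_ract ract_sact sact_minus sact_add
    show "glue_sact V k (glue_ract V a z) = glue_ract V (k \<odot>\<^bsub>A\<^esub> a) z"
      using k z by (simp add: glue_ract_eq) (auto simp: glue_sact_def intro!: restrict_ext)
    show "glue_ract V a (glue_sact V k z) = glue_ract V (k \<odot>\<^bsub>A\<^esub> a) z"
      unfolding glue_ract_eq[OF k(2) glue_sact_closed[OF k(1) z]] glue_ract_eq[OF smult_closed[OF k] z]
      using k by (auto simp: glue_sact_def intro!: restrict_ext)
  qed
  note I = left_module_homotopeI[OF closed(2) abelian_group_glue, where s = "glue_sact V" and r = "glue_ract V"]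
  note simps = glue_smult_eq glue_add_eq[symmetric] glue_sact_closed glue_ract_closed
    glue_ract_glue_ract 1 2 3 4
  show "left_module (homotope K A \<Delta>') (glue V)"
    by (rule I(1)) (simp_all add: simps)
  show "sact (glue V) k z = glue_sact V k z" if "k \<in> carrier K" "z \<in> carrier (glue V)" for k z
    by (rule I(2)) (simp_all add: simps that)
  show "ract (glue V) a z = glue_ract V a z" if "a \<in> carrier A" "z \<in> carrier (glue V)" for a z
    by (rule I(3)) (simp_all add: simps that)
qed

end

section \<open>Functoriality\<close>

lemma (in homotope_module) lmod_homI:
  assumes W: "left_module (homotope K A \<Delta>) W" and h: "h \<in> carrier V \<rightarrow>\<^sub>E carrier W"
    and add: "\<And>x y. x \<in> carrier V \<Longrightarrow> y \<in> carrier V \<Longrightarrow> h (x \<oplus>\<^bsub>V\<^esub> y) = h x \<oplus>\<^bsub>W\<^esub> h y"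
    and sact: "\<And>k x. k \<in> carrier K \<Longrightarrow> x \<in> carrier V \<Longrightarrow> h (sact V k x) = sact W k (h x)"
    and ract: "\<And>a x. a \<in> carrier A \<Longrightarrow> x \<in> carrier V \<Longrightarrow> h (ract V a x) = ract W a (h x)"
  shows "h \<in> lmod_hom (homotope K A \<Delta>) V W"
proof -
  interpret W: left_module "homotope K A \<Delta>" W by fact
  interpret W: homotope_module K A \<Delta> W by unfold_locales simp
  have "h x \<in> carrier W" if "x \<in> carrier V" for x using h that by auto
  then show ?thesis
    using h by (auto simp: lmod_hom_def add sact ract smult_eq W.smult_eq)
qed

context homotope_equivalence
begin

lemma lmod_hom_sact:
  "h \<in> lmod_hom (homotope K A D) X Y \<Longrightarrow> k \<in> carrier K \<Longrightarrow> x \<in> carrier X \<Longrightarrow> h (sact X k x) = sact Y k (h x)"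
  by (simp add: sact_def lmod_hom_smult)

lemma lmod_hom_ract:
  "h \<in> lmod_hom (homotope K A D) X Y \<Longrightarrow> a \<in> carrier A \<Longrightarrow> x \<in> carrier X \<Longrightarrow> h (ract X a x) = ract Y a (h x)"
  by (simp add: ract_def lmod_hom_smult)

lemma moduleI: "left_module (homotope K A \<Delta>) V \<Longrightarrow> homotope_equivalence_module K A \<Delta> \<Delta>' c d u v h\<^sub>1 h\<^sub>2 V"
  by (intro homotope_equivalence_module.intro homotope_equivalence_axioms)

text \<open>\<open>h\<close> is applied to the element of \<open>X\<close> and, by postcomposition,
  to the function. Everything in \<open>glue\<close> is expressed by addition, negation and the two
  actions, all of which \<open>h\<close> preserves.\<close>

lemma glue_map_hom:
  assumes X: "left_module (homotope K A \<Delta>) X" and Y: "left_module (homotope K A \<Delta>) Y"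
    and h: "h \<in> lmod_hom (homotope K A \<Delta>) X Y"
  shows "restrict (glue_map h) (carrier (glue X)) \<in> lmod_hom (homotope K A \<Delta>') (glue X) (glue Y)"
proof -
  interpret X: homotope_equivalence_module K A \<Delta> \<Delta>' c d u v h\<^sub>1 h\<^sub>2 X by (rule moduleI[OF X])
  interpret Y: homotope_equivalence_module K A \<Delta> \<Delta>' c d u v h\<^sub>1 h\<^sub>2 Y by (rule moduleI[OF Y])
  interpret GX: left_module "homotope K A \<Delta>'" "glue X" by (rule X.left_module_glue)
  interpret GX: homotope_module K A \<Delta>' "glue X" by unfold_locales simp
  note hh = lmod_hom_closed[OF h] lmod_hom_add[OF h] lmod_hom_sact[OF h] lmod_hom_ract[OF h]
  have h0: "h \<zero>\<^bsub>X\<^esub> = \<zero>\<^bsub>Y\<^esub>" and hm: "\<And>x. x \<in> carrier X \<Longrightarrow> h (\<ominus>\<^bsub>X\<^esub> x) = \<ominus>\<^bsub>Y\<^esub> h x"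
    by (rule additive_zero[OF X.V.abelian_group_axioms Y.V.abelian_group_axioms]; simp add: hh)
      (rule additive_minus[OF X.V.abelian_group_axioms Y.V.abelian_group_axioms]; simp add: hh)
  have closed: "glue_map h z \<in> carrier (glue Y)" if z: "z \<in> carrier (glue X)" for z
    unfolding glue_map_def
  proof (rule Y.glue_carrierI)
    note z' = X.glue_carrierD[OF z]
    note [simp] = X.plus_homs_closed[OF z'(2)] z'(1)
    show "h (fst z) \<in> carrier Y" by (simp add: hh)
    show "(\<lambda>b\<in>carrier A. h (snd z b)) \<in> plus_homs \<Delta> Y"
      by (rule Y.plus_homsI)
        (simp_all add: hh X.plus_homs_add[OF z'(2)] X.plus_homs_sact[OF z'(2)] X.plus_homs_ract[OF z'(2), symmetric])
    fix a assume a: "a \<in> carrier A"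
    have "h (ract X (a \<otimes>\<^bsub>A\<^esub> h\<^sub>2) (fst z) \<oplus>\<^bsub>X\<^esub> snd z (a \<otimes>\<^bsub>A\<^esub> v)) = \<zero>\<^bsub>Y\<^esub>"
      by (simp only: z'(3)[OF a] h0)
    then show "ract Y (a \<otimes>\<^bsub>A\<^esub> h\<^sub>2) (h (fst z)) \<oplus>\<^bsub>Y\<^esub> (\<lambda>b\<in>carrier A. h (snd z b)) (a \<otimes>\<^bsub>A\<^esub> v) = \<zero>\<^bsub>Y\<^esub>"
      using a by (simp add: hh)
  qed
  show ?thesis
  proof (rule GX.lmod_homI[OF Y.left_module_glue])
    fix x y assume x: "x \<in> carrier (glue X)" and y: "y \<in> carrier (glue X)"
    note x' = X.glue_carrierD[OF x] and y' = X.glue_carrierD[OF y]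
    note [simp] = X.plus_homs_closed[OF x'(2)] X.plus_homs_closed[OF y'(2)] x'(1) y'(1)
    have "glue_map h (x \<oplus>\<^bsub>glue X\<^esub> y) = glue_map h x \<oplus>\<^bsub>glue Y\<^esub> glue_map h y"
      by (auto simp: X.glue_add_eq Y.glue_add_eq glue_add_def glue_map_def hh intro!: restrict_ext)
    then show "restrict (glue_map h) (carrier (glue X)) (x \<oplus>\<^bsub>glue X\<^esub> y) =
      restrict (glue_map h) (carrier (glue X)) x \<oplus>\<^bsub>glue Y\<^esub> restrict (glue_map h) (carrier (glue X)) y"
      using x y by simp
  next
    fix k x assume k: "k \<in> carrier K" and x: "x \<in> carrier (glue X)"
    note x' = X.glue_carrierD[OF x]
    note [simp] = X.plus_homs_closed[OF x'(2)] x'(1)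
    have "glue_map h (glue_sact X k x) = glue_sact Y k (glue_map h x)"
      using k by (auto simp: glue_sact_def glue_map_def hh intro!: restrict_ext)
    then show "restrict (glue_map h) (carrier (glue X)) (sact (glue X) k x) =
      sact (glue Y) k (restrict (glue_map h) (carrier (glue X)) x)"
      using x k closed[OF x] by (simp add: X.glue_sact Y.glue_sact X.glue_sact_closed)
  next
    fix a x assume a: "a \<in> carrier A" and x: "x \<in> carrier (glue X)"
    note x' = X.glue_carrierD[OF x]
    note [simp] = X.plus_homs_closed[OF x'(2)] x'(1)
    have "glue_map h (glue_ract X a x) = glue_ract Y a (glue_map h x)"
      using a unfolding X.glue_ract_eq[OF a x] Y.glue_ract_eq[OF a closed[OF x]]
      by (auto simp: glue_map_def hh hm intro!: restrict_ext)
    then show "restrict (glue_map h) (carrier (glue X)) (ract (glue X) a x) =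
      ract (glue Y) a (restrict (glue_map h) (carrier (glue X)) x)"
      using x a closed[OF x] by (simp add: X.glue_ract Y.glue_ract X.glue_ract_closed)
  qed (use closed in auto)
qed

text \<open>The restriction in \<open>glue_map\<close> changes nothing because members of
  \<open>plus_homs\<close> are extensional.\<close>

lemma glue_map_id:
  assumes "left_module (homotope K A \<Delta>) X" "z \<in> carrier (glue X)"
    and "\<And>x. x \<in> carrier X \<Longrightarrow> h x = x"
  shows "glue_map h z = z"
proof -
  interpret X: homotope_equivalence_module K A \<Delta> \<Delta>' c d u v h\<^sub>1 h\<^sub>2 X by (rule moduleI) fact
  note z = X.glue_carrierD[OF assms(2)]
  have "snd z \<in> extensional (carrier A)" using z(2) by (simp add: plus_homs_def PiE_def)
  then show ?thesis
    using z(1) assms(3) X.plus_homs_closed[OF z(2)]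
    by (auto simp: glue_map_def prod_eq_iff fun_eq_iff extensional_def)
qed

lemma glue_map_comp: "glue_map g (glue_map f z) = glue_map (\<lambda>x. g (f x)) z"
  by (auto simp: glue_map_def)

lemma glue_map_cong:
  assumes "left_module (homotope K A \<Delta>) X" "z \<in> carrier (glue X)"
    and "\<And>x. x \<in> carrier X \<Longrightarrow> f x = g x"
  shows "glue_map f z = glue_map g z"
proof -
  interpret X: homotope_equivalence_module K A \<Delta> \<Delta>' c d u v h\<^sub>1 h\<^sub>2 X by (rule moduleI) fact
  note z = X.glue_carrierD[OF assms(2)]
  show ?thesis
    using z assms(3) X.plus_homs_closed[OF z(2)] by (auto simp: glue_map_def)
qed

text \<open>The inverse is the image of the inverse. \<open>X\<close> and \<open>Y\<close> may live
  in different types, as happens for the recoding of \<open>glue X\<close> into the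
  universe.\<close>

lemma glue_map_iso:
  assumes X: "left_module (homotope K A \<Delta>) X" and Y: "left_module (homotope K A \<Delta>) Y"
    and h: "h \<in> lmod_iso (homotope K A \<Delta>) X Y"
  shows "restrict (glue_map h) (carrier (glue X)) \<in> lmod_iso (homotope K A \<Delta>') (glue X) (glue Y)"
proof -
  let ?i = "restrict (inv_into (carrier X) h) (carrier Y)"
  have h': "h \<in> lmod_hom (homotope K A \<Delta>) X Y" and b: "bij_betw h (carrier X) (carrier Y)"
    using h by (auto simp: lmod_iso_def)
  have i': "?i \<in> lmod_hom (homotope K A \<Delta>) Y X" using lmod_iso_inv[OF h X] by (auto simp: lmod_iso_def)
  have hi: "?i (h x) = x" if "x \<in> carrier X" for x
    using that b by (auto simp: bij_betw_def)
  have ih: "h (?i y) = y" if "y \<in> carrier Y" for y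
    using that b by (auto simp: bij_betw_def f_inv_into_f)
  note H = glue_map_hom[OF X Y h'] and I = glue_map_hom[OF Y X i']
  have cH: "glue_map h z \<in> carrier (glue Y)" if "z \<in> carrier (glue X)" for z
    using lmod_hom_closed[OF H that] that by simp
  have cI: "glue_map ?i z \<in> carrier (glue X)" if "z \<in> carrier (glue Y)" for z
    using lmod_hom_closed[OF I that] that by simp
  have "bij_betw (glue_map h) (carrier (glue X)) (carrier (glue Y))"
    by (rule bij_betw_byWitness[where f' = "glue_map ?i"])
      (use cH cI hi ih in \<open>auto simp: glue_map_comp glue_map_id[OF X] glue_map_id[OF Y] simp del: restrict_apply restrict_apply'\<close>)
  then show ?thesis using H by (simp add: lmod_iso_def cong: bij_betw_cong)
qed

end


section \<open>The round trip\<close>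

context homotope_equivalence
begin

text \<open>Solving the linear conditions that define the double construction \<open>glue (glue V)\<close> expresses all
  its components through a single \<open>x \<in> V\<close>; \<open>q\<close> is the coefficient that occurs in the solution.\<close>

definition q where "q = v \<otimes>\<^bsub>A\<^esub> (h\<^sub>1 \<otimes>\<^bsub>A\<^esub> c) \<ominus>\<^bsub>A\<^esub> h\<^sub>2 \<otimes>\<^bsub>A\<^esub> (\<Delta> \<otimes>\<^bsub>A\<^esub> h\<^sub>2)"

lemma q_closed [simp]: "q \<in> carrier A"
  by (simp add: q_def)

text \<open>\<open>q\<close> is a corrected homotopy: by this and \<open>q_Delta\<close> it can
  replace \<open>h\<^sub>2\<close> in \<open>u_c\<close> and \<open>v_d\<close>, and by
  \<open>d_q\<close> it satisfies \<open>d q = h\<^sub>1 c\<close> besides, an identity not assumed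
  of \<open>h\<^sub>2\<close>. The term subtracted in \<open>q\<close> cancels the surplus
  \<open>\<Delta> h\<^sub>2 \<Delta> h\<^sub>2\<close>.\<close>

lemma Delta_q: "\<Delta> \<otimes>\<^bsub>A\<^esub> q = \<Delta> \<otimes>\<^bsub>A\<^esub> h\<^sub>2"
proof -
  have "\<Delta> \<otimes>\<^bsub>A\<^esub> (v \<otimes>\<^bsub>A\<^esub> (h\<^sub>1 \<otimes>\<^bsub>A\<^esub> c)) = u \<otimes>\<^bsub>A\<^esub> c \<otimes>\<^bsub>A\<^esub> (\<Delta> \<otimes>\<^bsub>A\<^esub> h\<^sub>2)"
    by (simp add: A.m_assoc Delta'_h1_c[symmetric]) (simp add: A.m_assoc[symmetric] u_Delta')
  also have "\<dots> = \<Delta> \<otimes>\<^bsub>A\<^esub> h\<^sub>2 \<oplus>\<^bsub>A\<^esub> \<Delta> \<otimes>\<^bsub>A\<^esub> (h\<^sub>2 \<otimes>\<^bsub>A\<^esub> (\<Delta> \<otimes>\<^bsub>A\<^esub> h\<^sub>2))"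
    by (simp add: u_c A.l_distr A.m_assoc)
  finally show ?thesis
    by (simp add: q_def a_minus_def A.r_distr A.r_minus M.a_assoc M.r_neg)
qed

lemma q_Delta: "q \<otimes>\<^bsub>A\<^esub> \<Delta> = h\<^sub>2 \<otimes>\<^bsub>A\<^esub> \<Delta>"
proof -
  have "v \<otimes>\<^bsub>A\<^esub> (h\<^sub>1 \<otimes>\<^bsub>A\<^esub> c) \<otimes>\<^bsub>A\<^esub> \<Delta> = v \<otimes>\<^bsub>A\<^esub> (h\<^sub>1 \<otimes>\<^bsub>A\<^esub> \<Delta>') \<otimes>\<^bsub>A\<^esub> d"
    by (simp add: A.m_assoc c_Delta)
  also have "\<dots> = h\<^sub>2 \<otimes>\<^bsub>A\<^esub> (\<Delta> \<otimes>\<^bsub>A\<^esub> (v \<otimes>\<^bsub>A\<^esub> d))" by (simp add: v_h1_Delta' A.m_assoc)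
  also have "\<dots> = h\<^sub>2 \<otimes>\<^bsub>A\<^esub> \<Delta> \<oplus>\<^bsub>A\<^esub> h\<^sub>2 \<otimes>\<^bsub>A\<^esub> (\<Delta> \<otimes>\<^bsub>A\<^esub> h\<^sub>2) \<otimes>\<^bsub>A\<^esub> \<Delta>"
    by (simp add: v_d A.r_distr A.m_assoc)
  finally show ?thesis
    by (simp add: q_def a_minus_def A.l_distr A.l_minus M.a_assoc M.r_neg)
qed

lemma d_q: "d \<otimes>\<^bsub>A\<^esub> q = h\<^sub>1 \<otimes>\<^bsub>A\<^esub> c"
proof -
  have "d \<otimes>\<^bsub>A\<^esub> (v \<otimes>\<^bsub>A\<^esub> (h\<^sub>1 \<otimes>\<^bsub>A\<^esub> c)) = h\<^sub>1 \<otimes>\<^bsub>A\<^esub> c \<oplus>\<^bsub>A\<^esub> h\<^sub>1 \<otimes>\<^bsub>A\<^esub> (\<Delta>' \<otimes>\<^bsub>A\<^esub> (h\<^sub>1 \<otimes>\<^bsub>A\<^esub> c))"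
    by (simp add: A.m_assoc[symmetric] d_v A.l_distr)
  also have "h\<^sub>1 \<otimes>\<^bsub>A\<^esub> (\<Delta>' \<otimes>\<^bsub>A\<^esub> (h\<^sub>1 \<otimes>\<^bsub>A\<^esub> c)) = h\<^sub>1 \<otimes>\<^bsub>A\<^esub> (\<Delta>' \<otimes>\<^bsub>A\<^esub> d) \<otimes>\<^bsub>A\<^esub> h\<^sub>2"
    by (simp add: Delta'_h1_c) (simp add: A.m_assoc[symmetric] c_Delta)
  also have "\<dots> = d \<otimes>\<^bsub>A\<^esub> (h\<^sub>2 \<otimes>\<^bsub>A\<^esub> (\<Delta> \<otimes>\<^bsub>A\<^esub> h\<^sub>2))" by (simp add: h1_Delta'_d A.m_assoc)
  finally show ?thesis
    by (simp add: q_def a_minus_def A.r_distr A.r_minus M.a_assoc M.r_neg)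
qed

definition orbit where "orbit V x = (\<lambda>b\<in>carrier A. ract V b x)"

text \<open>Dictated by the inverse problem: an element of the double construction amounts to
  \<open>(x\<^sub>0, \<phi>)\<close> and some \<open>y \<in> W\<close>. The proof of
  \<open>unit_map_surj\<close> finds \<open>x = x\<^sub>0 - y 1\<close> with
  \<open>y = q g x\<close>, so that \<open>x\<^sub>0 = x + q x\<close> and
  \<open>\<phi> = - d h\<^sub>2 g x\<close>. In \<open>unit_map\<close>, \<open>y\<close> is
  recorded as the homomorphism \<open>a \<mapsto> inn (a y)\<close>.\<close>

definition unit_point where
  "unit_point V x = (x \<oplus>\<^bsub>V\<^esub> ract V q x, \<lambda>b\<in>carrier A. \<ominus>\<^bsub>V\<^esub> ract V (b \<otimes>\<^bsub>A\<^esub> (d \<otimes>\<^bsub>A\<^esub> h\<^sub>2)) x)"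

definition unit_map where
  "unit_map V x = (unit_point V x, \<lambda>a\<in>carrier A. inn V (shift (a \<otimes>\<^bsub>A\<^esub> q) (orbit V x)))"

end

context homotope_equivalence_module
begin

lemma shift_add:
  "a \<in> carrier A \<Longrightarrow> b \<in> carrier A \<Longrightarrow> \<phi> \<in> plus_homs \<Delta> V \<Longrightarrow>
    shift (a \<oplus>\<^bsub>A\<^esub> b) \<phi> = (\<lambda>x\<in>carrier A. shift a \<phi> x \<oplus>\<^bsub>V\<^esub> shift b \<phi> x)"
  by (auto simp: shift_def A.r_distr plus_homs_add[of \<phi>])

lemma shift_sact:
  "k \<in> carrier K \<Longrightarrow> a \<in> carrier A \<Longrightarrow> \<phi> \<in> plus_homs \<Delta> V \<Longrightarrow>
    shift (k \<odot>\<^bsub>A\<^esub> a) \<phi> = (\<lambda>x\<in>carrier A. sact V k (shift a \<phi> x))"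
  by (auto simp: shift_def smult_mult_right plus_homs_sact[of \<phi>])

lemma inn_add:
  assumes \<phi>: "\<phi> \<in> plus_homs \<Delta> V" and \<chi>: "\<chi> \<in> plus_homs \<Delta> V"
  shows "inn V (\<lambda>b\<in>carrier A. \<phi> b \<oplus>\<^bsub>V\<^esub> \<chi> b) = inn V \<phi> \<oplus>\<^bsub>glue V\<^esub> inn V \<chi>"
  by (auto simp: inn_def glue_add_eq glue_add_def V.minus_add plus_homs_closed[OF \<phi>] plus_homs_closed[OF \<chi>]
      intro!: restrict_ext)

lemma inn_sact:
  assumes \<phi>: "\<phi> \<in> plus_homs \<Delta> V" and k: "k \<in> carrier K"
  shows "inn V (\<lambda>b\<in>carrier A. sact V k (\<phi> b)) = glue_sact V k (inn V \<phi>)"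
  using k by (auto simp: inn_def glue_sact_def sact_minus plus_homs_closed[OF \<phi>] intro!: restrict_ext)

lemma ract_inn:
  assumes \<phi>: "\<phi> \<in> plus_homs \<Delta> V" and a: "a \<in> carrier A"
  shows "ract (glue V) a (inn V \<phi>) = inn V (shift (a \<otimes>\<^bsub>A\<^esub> \<Delta>') \<phi>)"
  by (simp add: glue_ract a inn_closed[OF \<phi>] glue_ract_def out_inn[OF \<phi>] shift_shift)

text \<open>The construction applied a second time, to \<open>glue V\<close> with the swapped and
  signed data.\<close>

interpretation G: homotope_equivalence_module K A \<Delta>' \<Delta> "\<ominus>\<^bsub>A\<^esub> u" "\<ominus>\<^bsub>A\<^esub> v" "\<ominus>\<^bsub>A\<^esub> c" "\<ominus>\<^bsub>A\<^esub> d" h\<^sub>2 h\<^sub>1 "glue V"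
  by (intro homotope_equivalence_module.intro swapped left_module_glue)

text \<open>With \<open>inn_cancel\<close> and \<open>plus_homs_glue_eq_lift\<close> this identifies
  \<open>W\<close> with the homomorphisms into \<open>glue V\<close> from the augmentation ideal of
  the second homotope, via \<open>\<phi> \<mapsto> (a \<mapsto> inn (a \<phi>))\<close>.\<close>

lemma lift_closed:
  assumes \<phi>: "\<phi> \<in> plus_homs \<Delta> V"
  shows "(\<lambda>a\<in>carrier A. inn V (shift a \<phi>)) \<in> plus_homs \<Delta>' (glue V)"
  by (rule G.plus_homsI)
    (simp_all add: inn_closed shift_closed \<phi> shift_add inn_add shift_sact inn_sact ract_inn shift_shift glue_sact)

text \<open>Applying \<open>out\<close> to \<open>inn (b \<phi>)\<close> gives
  \<open>\<Delta>' b \<phi>\<close>, whose value at \<open>a\<close> is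
  \<open>\<phi> (a \<Delta>' b)\<close>; the products \<open>a \<Delta>' b\<close> generate
  \<open>A\<close> additively.\<close>

lemma inn_cancel:
  assumes \<phi>: "\<phi> \<in> plus_homs \<Delta> V" and \<chi>: "\<chi> \<in> plus_homs \<Delta> V"
    and eq: "\<And>a. a \<in> carrier A \<Longrightarrow> inn V (shift a \<phi>) = inn V (shift a \<chi>)"
  shows "\<phi> = \<chi>"
proof (rule plus_homs_eqI[OF \<phi> \<chi>])
  fix a assume a: "a \<in> carrier A"
  show "\<phi> a = \<chi> a" using a
  proof (induction rule: homotope_plus_generated_induct[OF surj' closed(2)])
    case (4 a b)
    have "shift \<Delta>' (shift b \<phi>) a = shift \<Delta>' (shift b \<chi>) a"
      using out_inn[OF shift_closed[OF 4(2) \<phi>]] out_inn[OF shift_closed[OF 4(2) \<chi>]] eq[OF 4(2)] by simp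
    then show ?case using 4 by (simp add: shift_def)
  qed (simp_all add: plus_homs_zero[OF \<phi>] plus_homs_zero[OF \<chi>] plus_homs_add[OF \<phi>] plus_homs_add[OF \<chi>] a)
qed

section \<open>The comparison map from \<open>V\<close> to the double construction\<close>

lemma orbit_closed: "x \<in> carrier V \<Longrightarrow> orbit V x \<in> plus_homs \<Delta> V"
  unfolding orbit_def by (rule ract_hom)

lemma orbit_ract:
  assumes "x \<in> carrier V" "a \<in> carrier A"
  shows "orbit V (ract V a x) = shift (\<Delta> \<otimes>\<^bsub>A\<^esub> a) (orbit V x)"
  using assms by (auto simp: orbit_def shift_def ract_ract A.m_assoc intro!: restrict_ext)

text \<open>The kernel condition is \<open>h\<^sub>2 + h\<^sub>2 \<Delta> q = v d h\<^sub>2\<close>,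
  which follows from \<open>Delta_q\<close> and \<open>v_d\<close>.\<close>

lemma unit_point_closed:
  assumes x: "x \<in> carrier V"
  shows "unit_point V x \<in> carrier (glue V)"
  unfolding unit_point_def
proof (rule glue_carrierI)
  have "(\<lambda>b\<in>carrier A. \<ominus>\<^bsub>V\<^esub> shift (d \<otimes>\<^bsub>A\<^esub> h\<^sub>2) (orbit V x) b) \<in> plus_homs \<Delta> V"
    by (intro plus_homs_pointwise_minus shift_closed orbit_closed x) simp
  also have "(\<lambda>b\<in>carrier A. \<ominus>\<^bsub>V\<^esub> shift (d \<otimes>\<^bsub>A\<^esub> h\<^sub>2) (orbit V x) b) =
      (\<lambda>b\<in>carrier A. \<ominus>\<^bsub>V\<^esub> ract V (b \<otimes>\<^bsub>A\<^esub> (d \<otimes>\<^bsub>A\<^esub> h\<^sub>2)) x)"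
    by (auto simp: shift_def orbit_def)
  finally show "(\<lambda>b\<in>carrier A. \<ominus>\<^bsub>V\<^esub> ract V (b \<otimes>\<^bsub>A\<^esub> (d \<otimes>\<^bsub>A\<^esub> h\<^sub>2)) x) \<in> plus_homs \<Delta> V" .
  fix a assume a: "a \<in> carrier A"
  have "h\<^sub>2 \<oplus>\<^bsub>A\<^esub> h\<^sub>2 \<otimes>\<^bsub>A\<^esub> (\<Delta> \<otimes>\<^bsub>A\<^esub> q) = v \<otimes>\<^bsub>A\<^esub> d \<otimes>\<^bsub>A\<^esub> h\<^sub>2"
    by (simp add: Delta_q v_d A.l_distr A.m_assoc)
  then have "ract V (a \<otimes>\<^bsub>A\<^esub> (h\<^sub>2 \<oplus>\<^bsub>A\<^esub> h\<^sub>2 \<otimes>\<^bsub>A\<^esub> (\<Delta> \<otimes>\<^bsub>A\<^esub> q))) x = ract V (a \<otimes>\<^bsub>A\<^esub> (v \<otimes>\<^bsub>A\<^esub> d \<otimes>\<^bsub>A\<^esub> h\<^sub>2)) x"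
    by simp
  then have "ract V (a \<otimes>\<^bsub>A\<^esub> h\<^sub>2) x \<oplus>\<^bsub>V\<^esub> ract V (a \<otimes>\<^bsub>A\<^esub> h\<^sub>2) (ract V q x) = ract V (a \<otimes>\<^bsub>A\<^esub> v \<otimes>\<^bsub>A\<^esub> (d \<otimes>\<^bsub>A\<^esub> h\<^sub>2)) x"
    using a x by (simp add: ract_ract A.m_assoc A.r_distr ract_add_left)
  then show "ract V (a \<otimes>\<^bsub>A\<^esub> h\<^sub>2) (x \<oplus>\<^bsub>V\<^esub> ract V q x) \<oplus>\<^bsub>V\<^esub>
      (\<lambda>b\<in>carrier A. \<ominus>\<^bsub>V\<^esub> ract V (b \<otimes>\<^bsub>A\<^esub> (d \<otimes>\<^bsub>A\<^esub> h\<^sub>2)) x) (a \<otimes>\<^bsub>A\<^esub> v) = \<zero>\<^bsub>V\<^esub>"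
    using a x by (simp add: ract_add V.r_neg)
qed (use x in simp)

text \<open>The term \<open>c \<Delta> q = c \<Delta> h\<^sub>2 = \<Delta>' d h\<^sub>2\<close>
  coming from \<open>q x\<close> cancels against the second coordinate, leaving
  \<open>c g x\<close>.\<close>

lemma out_unit_point:
  assumes x: "x \<in> carrier V"
  shows "out V (unit_point V x) = shift c (orbit V x)"
  unfolding out_def shift_def
proof (rule restrict_ext)
  fix b assume b: "b \<in> carrier A"
  have "c \<otimes>\<^bsub>A\<^esub> (\<Delta> \<otimes>\<^bsub>A\<^esub> q) = \<Delta>' \<otimes>\<^bsub>A\<^esub> (d \<otimes>\<^bsub>A\<^esub> h\<^sub>2)"
    by (simp add: Delta_q) (simp add: A.m_assoc[symmetric] c_Delta)
  then have "ract V (b \<otimes>\<^bsub>A\<^esub> c) (ract V q x) = ract V (b \<otimes>\<^bsub>A\<^esub> \<Delta>' \<otimes>\<^bsub>A\<^esub> (d \<otimes>\<^bsub>A\<^esub> h\<^sub>2)) x"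
    using b x by (simp add: ract_ract A.m_assoc)
  then show "ract V (b \<otimes>\<^bsub>A\<^esub> c) (fst (unit_point V x)) \<oplus>\<^bsub>V\<^esub> snd (unit_point V x) (b \<otimes>\<^bsub>A\<^esub> \<Delta>') =
      orbit V x (b \<otimes>\<^bsub>A\<^esub> c)"
    using b x by (simp add: unit_point_def orbit_def ract_add V.a_assoc V.r_neg)
qed

lemma ract_unit_point:
  assumes x: "x \<in> carrier V" and a: "a \<in> carrier A"
  shows "ract (glue V) a (unit_point V x) = inn V (shift (a \<otimes>\<^bsub>A\<^esub> c) (orbit V x))"
  using a by (simp add: glue_ract unit_point_closed[OF x] glue_ract_def out_unit_point[OF x] shift_shift)

lemma unit_map_snd_closed:
  assumes x: "x \<in> carrier V"
  shows "snd (unit_map V x) \<in> plus_homs \<Delta>' (glue V)"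
proof -
  have "shift q (\<lambda>a\<in>carrier A. inn V (shift a (orbit V x))) \<in> plus_homs \<Delta>' (glue V)"
    by (intro G.shift_closed lift_closed orbit_closed x) simp
  then show ?thesis by (simp add: shift_def[of q] unit_map_def cong: restrict_cong)
qed

text \<open>With the swapped data the kernel condition compares \<open>h\<^sub>1\<close> on the
  point with \<open>d\<close> on the homomorphism. Both sides are \<open>inn\<close> of a multiple
  of \<open>orbit V x\<close>, by \<open>h\<^sub>1 c\<close> and by \<open>d q\<close>.\<close>

lemma unit_map_closed:
  assumes x: "x \<in> carrier V"
  shows "unit_map V x \<in> carrier (G.glue (glue V))"
proof -
  have "(unit_point V x, snd (unit_map V x)) \<in> carrier (G.glue (glue V))"
  proof (rule G.glue_carrierI[OF unit_point_closed[OF x] unit_map_snd_closed[OF x]])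
    fix a assume a: "a \<in> carrier A"
    have "snd (unit_map V x) (a \<otimes>\<^bsub>A\<^esub> (\<ominus>\<^bsub>A\<^esub> d)) = \<ominus>\<^bsub>glue V\<^esub> snd (unit_map V x) (a \<otimes>\<^bsub>A\<^esub> d)"
      using a by (simp add: A.r_minus G.plus_homs_minus[OF unit_map_snd_closed[OF x]])
    also have "snd (unit_map V x) (a \<otimes>\<^bsub>A\<^esub> d) = ract (glue V) (a \<otimes>\<^bsub>A\<^esub> h\<^sub>1) (unit_point V x)"
      using a by (simp add: unit_map_def ract_unit_point[OF x] A.m_assoc d_q)
    finally show "ract (glue V) (a \<otimes>\<^bsub>A\<^esub> h\<^sub>1) (unit_point V x) \<oplus>\<^bsub>glue V\<^esub>
        snd (unit_map V x) (a \<otimes>\<^bsub>A\<^esub> (\<ominus>\<^bsub>A\<^esub> d)) = \<zero>\<^bsub>glue V\<^esub>"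
      using a unit_point_closed[OF x] by (simp add: G.V.r_neg)
  qed
  then show ?thesis by (simp add: unit_map_def)
qed

text \<open>At the second stage \<open>out\<close> has coefficients \<open>- u\<close> and
  \<open>\<Delta>\<close>, and gives minus the lift of \<open>orbit V x\<close>, since
  \<open>- u c + \<Delta> q = - 1\<close>. Both coefficients of the second-stage \<open>inn\<close>,
  \<open>- d\<close> and \<open>- h\<^sub>2 \<Delta>\<close>, are negative as well, so the signs
  cancel.\<close>

lemma unit_map_ract:
  assumes x: "x \<in> carrier V" and a: "a \<in> carrier A"
  shows "unit_map V (ract V a x) = G.glue_ract (glue V) a (unit_map V x)"
proof -
  \<comment> \<open>Both sides are rewritten as values of the lift \<open>L\<close>, after which
    only identities in \<open>A\<close> remain.\<close>
  define L where "L = (\<lambda>a\<in>carrier A. inn V (shift a (orbit V x)))"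
  have L: "L \<in> plus_homs \<Delta>' (glue V)" unfolding L_def by (intro lift_closed orbit_closed x)
  note [simp] = G.plus_homs_closed[OF L]
  have L_eq: "inn V (shift b (orbit V x)) = L b" if "b \<in> carrier A" for b
    using that by (simp add: L_def)
  have uc: "\<ominus>\<^bsub>A\<^esub> (b \<otimes>\<^bsub>A\<^esub> (u \<otimes>\<^bsub>A\<^esub> c)) \<oplus>\<^bsub>A\<^esub> b \<otimes>\<^bsub>A\<^esub> (\<Delta> \<otimes>\<^bsub>A\<^esub> q) = \<ominus>\<^bsub>A\<^esub> b" if "b \<in> carrier A" for b
    using that by (simp add: u_c Delta_q A.r_distr M.minus_add M.a_assoc M.l_neg)
  have out: "G.out (glue V) (unit_map V x) b = L (\<ominus>\<^bsub>A\<^esub> b)" if b: "b \<in> carrier A" for b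
  proof -
    have "G.out (glue V) (unit_map V x) b = L (\<ominus>\<^bsub>A\<^esub> (b \<otimes>\<^bsub>A\<^esub> (u \<otimes>\<^bsub>A\<^esub> c))) \<oplus>\<^bsub>glue V\<^esub> L (b \<otimes>\<^bsub>A\<^esub> (\<Delta> \<otimes>\<^bsub>A\<^esub> q))"
      using b by (simp add: G.out_def unit_map_def ract_unit_point[OF x] L_eq A.m_assoc A.r_minus A.l_minus)
    also have "\<dots> = L (\<ominus>\<^bsub>A\<^esub> b)"
      using b by (simp add: G.plus_homs_add[OF L, symmetric] uc)
    finally show ?thesis .
  qed
  have act: "G.glue_ract (glue V) a (unit_map V x) =
      (L (d \<otimes>\<^bsub>A\<^esub> a), \<lambda>b\<in>carrier A. L (b \<otimes>\<^bsub>A\<^esub> (h\<^sub>2 \<otimes>\<^bsub>A\<^esub> (\<Delta> \<otimes>\<^bsub>A\<^esub> a))))"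
    using a by (auto simp: G.glue_ract_def G.inn_def shift_def out A.l_minus A.m_assoc G.plus_homs_minus[OF L]
      intro!: restrict_ext)
  \<comment> \<open>The coordinates match by \<open>v d = 1 + q \<Delta>\<close> and
    \<open>d h\<^sub>2 \<Delta> = h\<^sub>1 \<Delta>' d\<close>.\<close>
  have 1: "unit_point V (ract V a x) = L (d \<otimes>\<^bsub>A\<^esub> a)"
  proof -
    have "ract V a x \<oplus>\<^bsub>V\<^esub> ract V q (ract V a x) = ract V (v \<otimes>\<^bsub>A\<^esub> d \<otimes>\<^bsub>A\<^esub> a) x"
      using a x by (simp add: ract_ract q_Delta v_d A.l_distr ract_add_left)
    moreover have "ract V (b \<otimes>\<^bsub>A\<^esub> (d \<otimes>\<^bsub>A\<^esub> h\<^sub>2)) (ract V a x) =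
        ract V (b \<otimes>\<^bsub>A\<^esub> (h\<^sub>1 \<otimes>\<^bsub>A\<^esub> (\<Delta>' \<otimes>\<^bsub>A\<^esub> d)) \<otimes>\<^bsub>A\<^esub> a) x" if "b \<in> carrier A" for b
      using a x that by (simp add: ract_ract h1_Delta'_d) (simp add: A.m_assoc)
    ultimately show ?thesis
      using a x by (auto simp: unit_point_def L_def inn_def shift_def orbit_def A.m_assoc intro!: restrict_ext)
  qed
  have 2: "inn V (shift (b \<otimes>\<^bsub>A\<^esub> q) (orbit V (ract V a x))) = L (b \<otimes>\<^bsub>A\<^esub> (h\<^sub>2 \<otimes>\<^bsub>A\<^esub> (\<Delta> \<otimes>\<^bsub>A\<^esub> a)))"
    if b: "b \<in> carrier A" for b
  proof -
    have "b \<otimes>\<^bsub>A\<^esub> q \<otimes>\<^bsub>A\<^esub> (\<Delta> \<otimes>\<^bsub>A\<^esub> a) = b \<otimes>\<^bsub>A\<^esub> (q \<otimes>\<^bsub>A\<^esub> \<Delta>) \<otimes>\<^bsub>A\<^esub> a" using a b by (simp add: A.m_assoc)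
    also have "\<dots> = b \<otimes>\<^bsub>A\<^esub> (h\<^sub>2 \<otimes>\<^bsub>A\<^esub> (\<Delta> \<otimes>\<^bsub>A\<^esub> a))" using a b by (simp add: q_Delta A.m_assoc)
    finally show ?thesis using a b x by (simp add: orbit_ract shift_shift L_eq)
  qed
  show ?thesis unfolding act by (auto simp: unit_map_def[of V "ract V a x"] 1 2 intro!: restrict_ext)
qed

lemma unit_map_hom:
  "restrict (unit_map V) (carrier V) \<in> lmod_hom (homotope K A \<Delta>) V (G.glue (glue V))"
proof (rule lmod_homI[OF G.left_module_glue])
  fix x y assume [simp]: "x \<in> carrier V" "y \<in> carrier V"
  have "unit_point V (x \<oplus>\<^bsub>V\<^esub> y) = unit_point V x \<oplus>\<^bsub>glue V\<^esub> unit_point V y"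
    by (auto simp: unit_point_def glue_add_eq glue_add_def ract_add V.minus_add V.a_ac intro!: restrict_ext)
  moreover have "inn V (shift (a \<otimes>\<^bsub>A\<^esub> q) (orbit V (x \<oplus>\<^bsub>V\<^esub> y))) =
      inn V (shift (a \<otimes>\<^bsub>A\<^esub> q) (orbit V x)) \<oplus>\<^bsub>glue V\<^esub> inn V (shift (a \<otimes>\<^bsub>A\<^esub> q) (orbit V y))"
    if "a \<in> carrier A" for a
    using that by (auto simp: glue_add_eq glue_add_def inn_def shift_def orbit_def ract_add V.minus_add intro!: restrict_ext)
  ultimately show "restrict (unit_map V) (carrier V) (x \<oplus>\<^bsub>V\<^esub> y) =
      restrict (unit_map V) (carrier V) x \<oplus>\<^bsub>G.glue (glue V)\<^esub> restrict (unit_map V) (carrier V) y"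
    by (auto simp: unit_map_def G.glue_add_eq G.glue_add_def intro!: restrict_ext)
next
  fix k x assume [simp]: "k \<in> carrier K" "x \<in> carrier V"
  have "unit_point V (sact V k x) = glue_sact V k (unit_point V x)"
    by (auto simp: unit_point_def glue_sact_def sact_add sact_minus sact_ract ract_sact intro!: restrict_ext)
  moreover have "inn V (shift (a \<otimes>\<^bsub>A\<^esub> q) (orbit V (sact V k x))) =
      glue_sact V k (inn V (shift (a \<otimes>\<^bsub>A\<^esub> q) (orbit V x)))"
    if "a \<in> carrier A" for a
    using that by (auto simp: glue_sact_def inn_def shift_def orbit_def sact_minus sact_ract ract_sact intro!: restrict_ext)
  ultimately have "unit_map V (sact V k x) = G.glue_sact (glue V) k (unit_map V x)"
    by (auto simp: unit_map_def G.glue_sact_def glue_sact unit_point_closed inn_closed shift_closed orbit_closed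
        intro!: restrict_ext)
  then show "restrict (unit_map V) (carrier V) (sact V k x) =
      sact (G.glue (glue V)) k (restrict (unit_map V) (carrier V) x)"
    by (simp add: G.glue_sact unit_map_closed)
next
  fix a x assume [simp]: "a \<in> carrier A" "x \<in> carrier V"
  show "restrict (unit_map V) (carrier V) (ract V a x) =
      ract (G.glue (glue V)) a (restrict (unit_map V) (carrier V) x)"
    by (simp add: G.glue_ract unit_map_closed unit_map_ract)
qed (use unit_map_closed in auto)

text \<open>The homomorphism part determines \<open>q g x\<close> by \<open>inn_cancel\<close>,
  hence \<open>q x\<close> by evaluation at 1; the first coordinate of the point is
  \<open>x + q x\<close>.\<close>

lemma unit_map_inj: "inj_on (unit_map V) (carrier V)"
proof (rule inj_onI)
  fix x y assume x: "x \<in> carrier V" and y: "y \<in> carrier V" and eq: "unit_map V x = unit_map V y"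
  have "shift q (orbit V x) = shift q (orbit V y)"
  proof (rule inn_cancel)
    fix a assume a: "a \<in> carrier A"
    have "snd (unit_map V x) a = snd (unit_map V y) a" using eq by simp
    then show "inn V (shift a (shift q (orbit V x))) = inn V (shift a (shift q (orbit V y)))"
      using a by (simp add: unit_map_def shift_shift)
  qed (simp_all add: shift_closed orbit_closed x y)
  then have "shift q (orbit V x) \<one>\<^bsub>A\<^esub> = shift q (orbit V y) \<one>\<^bsub>A\<^esub>" by simp
  then have "ract V q x = ract V q y" by (simp add: shift_def orbit_def)
  moreover have "x \<oplus>\<^bsub>V\<^esub> ract V q x = y \<oplus>\<^bsub>V\<^esub> ract V q y"
    using eq by (simp add: unit_map_def unit_point_def)
  ultimately show "x = y" using x y by simp
qed

text \<open>Proved first for the translates \<open>b \<mapsto> \<psi> (b a)\<close>, so that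
  additive induction on \<open>a\<close> applies; the case \<open>a = 1\<close> is the
  claim.\<close>

lemma plus_homs_glue_eq_lift:
  assumes \<psi>: "\<psi> \<in> plus_homs \<Delta>' (glue V)"
  obtains y where "y \<in> plus_homs \<Delta> V" "\<And>b. b \<in> carrier A \<Longrightarrow> \<psi> b = inn V (shift b y)"
proof -
  have "\<exists>y\<in>plus_homs \<Delta> V. \<forall>b\<in>carrier A. \<psi> (b \<otimes>\<^bsub>A\<^esub> a) = inn V (shift b y)" if "a \<in> carrier A" for a
  proof (induction rule: homotope_plus_generated_induct[OF surj' closed(2) that])
    case 1
    have minus_zero: "\<ominus>\<^bsub>V\<^esub> \<zero>\<^bsub>V\<^esub> = \<zero>\<^bsub>V\<^esub>" using V.minus_equality[of "\<zero>\<^bsub>V\<^esub>" "\<zero>\<^bsub>V\<^esub>"] by simp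
    show ?case
      by (intro bexI[OF _ plus_homs_pointwise_zero])
        (auto simp: minus_zero G.plus_homs_zero[OF \<psi>] glue_zero_eq inn_def shift_def intro!: restrict_ext)
  next
    case (2 a a')
    then obtain y y' where y: "y \<in> plus_homs \<Delta> V" "y' \<in> plus_homs \<Delta> V"
        "\<And>b. b \<in> carrier A \<Longrightarrow> \<psi> (b \<otimes>\<^bsub>A\<^esub> a) = inn V (shift b y)"
        "\<And>b. b \<in> carrier A \<Longrightarrow> \<psi> (b \<otimes>\<^bsub>A\<^esub> a') = inn V (shift b y')"
      by auto
    have "\<psi> (b \<otimes>\<^bsub>A\<^esub> (a \<oplus>\<^bsub>A\<^esub> a')) = inn V (shift b (\<lambda>b\<in>carrier A. y b \<oplus>\<^bsub>V\<^esub> y' b))" if b: "b \<in> carrier A" for b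
    proof -
      have "shift b (\<lambda>b\<in>carrier A. y b \<oplus>\<^bsub>V\<^esub> y' b) = (\<lambda>x\<in>carrier A. shift b y x \<oplus>\<^bsub>V\<^esub> shift b y' x)"
        using b by (auto simp: shift_def)
      then show ?thesis
        using b 2 y by (simp add: inn_add shift_closed A.r_distr G.plus_homs_add[OF \<psi>])
    qed
    then show ?case using plus_homs_pointwise_add[OF y(1,2)] by blast
  next
    case (3 a a')
    \<comment> \<open>The witness comes from reading \<open>\<psi> (b a \<Delta>' a')\<close> as the
      action of \<open>b a\<close> on \<open>\<psi> a'\<close>, that is, as
      \<open>inn (b a (out (\<psi> a')))\<close>.\<close>
    let ?y = "shift a (out V (\<psi> a'))"
    have "?y \<in> plus_homs \<Delta> V" using 3 by (intro shift_closed out_closed G.plus_homs_closed[OF \<psi>])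
    moreover have "\<psi> (b \<otimes>\<^bsub>A\<^esub> (a \<otimes>\<^bsub>A\<^esub> \<Delta>' \<otimes>\<^bsub>A\<^esub> a')) = inn V (shift b ?y)" if b: "b \<in> carrier A" for b
    proof -
      have "\<psi> (b \<otimes>\<^bsub>A\<^esub> (a \<otimes>\<^bsub>A\<^esub> \<Delta>' \<otimes>\<^bsub>A\<^esub> a')) = ract (glue V) (b \<otimes>\<^bsub>A\<^esub> a) (\<psi> a')"
        using b 3 by (simp add: G.plus_homs_ract[OF \<psi>] A.m_assoc)
      then show ?thesis
        using b 3 by (simp add: glue_ract G.plus_homs_closed[OF \<psi>] glue_ract_def shift_shift)
    qed
    ultimately show ?case by blast
  qed
  from this[of "\<one>\<^bsub>A\<^esub>"] show ?thesis using that by auto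
qed

text \<open>An element is given by \<open>x0\<close>, \<open>\<phi>\<close> and \<open>y\<close>.
  The two kernel conditions, \<open>\<phi>_v\<close> from the inner construction and
  \<open>y_d\<close> from the outer one, are linear equations that are solved for
  \<open>x\<close>.\<close>

lemma unit_map_surj: "unit_map V ` carrier V = carrier (G.glue (glue V))"
proof (intro equalityI subsetI)
  fix w assume w: "w \<in> carrier (G.glue (glue V))"
  note w' = G.glue_carrierD[OF w]
  obtain y where y: "y \<in> plus_homs \<Delta> V" and snd_w: "\<And>b. b \<in> carrier A \<Longrightarrow> snd w b = inn V (shift b y)"
    using plus_homs_glue_eq_lift[OF w'(2)] by blast
  define z where "z = fst w"
  note z = w'(1)[folded z_def]
  note z' = glue_carrierD[OF z]
  define x0 and \<phi> where "x0 = fst z" and "\<phi> = snd z"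
  note x0 [simp] = z'(1)[folded x0_def] and \<phi> = z'(2)[folded \<phi>_def] and rel = z'(3)[folded x0_def \<phi>_def]
  note [simp] = plus_homs_closed[OF y] plus_homs_closed[OF \<phi>]
  \<comment> \<open>The outer kernel condition compares two lifts; \<open>inn_cancel\<close> turns
    it into the equation \<open>h\<^sub>1 (out z) = d y\<close> in \<open>W\<close>.\<close>
  have "shift h\<^sub>1 (out V z) = shift d y"
  proof (rule inn_cancel)
    fix a assume a: "a \<in> carrier A"
    have "ract (glue V) (a \<otimes>\<^bsub>A\<^esub> h\<^sub>1) z \<oplus>\<^bsub>glue V\<^esub> \<ominus>\<^bsub>glue V\<^esub> snd w (a \<otimes>\<^bsub>A\<^esub> d) = \<zero>\<^bsub>glue V\<^esub>"
      using a w'(3)[OF a] by (simp add: z_def A.r_minus G.plus_homs_minus[OF w'(2)])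
    from G.V.minus_equality[OF this] have "ract (glue V) (a \<otimes>\<^bsub>A\<^esub> h\<^sub>1) z = snd w (a \<otimes>\<^bsub>A\<^esub> d)"
      using a z by (simp add: G.plus_homs_closed[OF w'(2)])
    then show "inn V (shift a (shift h\<^sub>1 (out V z))) = inn V (shift a (shift d y))"
      using a z by (simp add: glue_ract glue_ract_def shift_shift snd_w)
  qed (simp_all add: shift_closed out_closed y z)
  note out_z_eq = this
  have y_d: "y (b \<otimes>\<^bsub>A\<^esub> d) = ract V (b \<otimes>\<^bsub>A\<^esub> (h\<^sub>1 \<otimes>\<^bsub>A\<^esub> c)) x0 \<oplus>\<^bsub>V\<^esub> \<phi> (b \<otimes>\<^bsub>A\<^esub> (h\<^sub>1 \<otimes>\<^bsub>A\<^esub> \<Delta>'))" if "b \<in> carrier A" for b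
    using fun_cong[OF out_z_eq, of b] that
    by (simp add: shift_def out_def A.m_assoc x0_def \<phi>_def)
  have \<phi>_v: "\<phi> (b \<otimes>\<^bsub>A\<^esub> v) = \<ominus>\<^bsub>V\<^esub> ract V (b \<otimes>\<^bsub>A\<^esub> h\<^sub>2) x0" if "b \<in> carrier A" for b
    using rel[OF that] that by (metis V.add.inv_equality V.a_comm A.m_closed closed(6,8) ract_closed x0 plus_homs_closed[OF \<phi>])
  \<comment> \<open>The point of \<open>unit_map V x\<close> has first coordinate
    \<open>x + q x\<close>, where \<open>q x\<close> has to be the value of \<open>y\<close> at 1;
    this forces the choice.\<close>
  define x where "x = x0 \<ominus>\<^bsub>V\<^esub> y \<one>\<^bsub>A\<^esub>"
  have x: "x \<in> carrier V" by (simp add: x_def)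
  have ract_x: "ract V a x = ract V a x0 \<ominus>\<^bsub>V\<^esub> y (a \<otimes>\<^bsub>A\<^esub> \<Delta>)" if "a \<in> carrier A" for a
    using that by (simp add: x_def a_minus_def ract_add ract_minus plus_homs_ract[OF y])
  \<comment> \<open>Evaluate \<open>y (b v d)\<close> twice: \<open>y_d\<close> together with
    \<open>\<phi>_v\<close> gives \<open>b q\<close> acting on \<open>x0\<close>, while
    \<open>v d = 1 + q \<Delta>\<close> gives \<open>y b + y (b q \<Delta>)\<close>.\<close>
  have orbit_q: "shift q (orbit V x) = y"
  proof (rule plus_homs_eqI[OF shift_closed[OF _ orbit_closed[OF x]] y])
    fix b assume b: "b \<in> carrier A"
    have "\<phi> (b \<otimes>\<^bsub>A\<^esub> v \<otimes>\<^bsub>A\<^esub> (h\<^sub>1 \<otimes>\<^bsub>A\<^esub> \<Delta>')) = \<phi> (b \<otimes>\<^bsub>A\<^esub> (h\<^sub>2 \<otimes>\<^bsub>A\<^esub> \<Delta>) \<otimes>\<^bsub>A\<^esub> v)"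
      using b by (simp add: A.m_assoc v_h1_Delta')
    also have "\<dots> = \<ominus>\<^bsub>V\<^esub> ract V (b \<otimes>\<^bsub>A\<^esub> (h\<^sub>2 \<otimes>\<^bsub>A\<^esub> (\<Delta> \<otimes>\<^bsub>A\<^esub> h\<^sub>2))) x0"
      using b \<phi>_v[of "b \<otimes>\<^bsub>A\<^esub> (h\<^sub>2 \<otimes>\<^bsub>A\<^esub> \<Delta>)"] by (simp add: A.m_assoc)
    finally have "y (b \<otimes>\<^bsub>A\<^esub> v \<otimes>\<^bsub>A\<^esub> d) = ract V (b \<otimes>\<^bsub>A\<^esub> q) x0"
      using b y_d[of "b \<otimes>\<^bsub>A\<^esub> v"] by (simp add: q_def a_minus_def A.r_distr A.r_minus ract_add_left ract_minus_left A.m_assoc)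
    moreover have "y (b \<otimes>\<^bsub>A\<^esub> v \<otimes>\<^bsub>A\<^esub> d) = y b \<oplus>\<^bsub>V\<^esub> y (b \<otimes>\<^bsub>A\<^esub> q \<otimes>\<^bsub>A\<^esub> \<Delta>)"
      using b by (simp add: A.m_assoc v_d q_Delta A.r_distr plus_homs_add[OF y])
    ultimately have "ract V (b \<otimes>\<^bsub>A\<^esub> q) x0 = y b \<oplus>\<^bsub>V\<^esub> y (b \<otimes>\<^bsub>A\<^esub> q \<otimes>\<^bsub>A\<^esub> \<Delta>)" by simp
    then show "shift q (orbit V x) b = y b"
      using b by (simp add: shift_def orbit_def ract_x a_minus_def V.a_assoc V.r_neg)
  qed simp
  have "unit_point V x = z"
  proof (rule glue_eqI[OF unit_point_closed[OF x] z])
    have "ract V q x = y \<one>\<^bsub>A\<^esub>" using fun_cong[OF orbit_q, of "\<one>\<^bsub>A\<^esub>"] by (simp add: shift_def orbit_def)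
    then show "fst (unit_point V x) = fst z"
      by (simp add: unit_point_def x_def a_minus_def V.a_assoc V.l_neg flip: x0_def)
    \<comment> \<open>For the second coordinate, \<open>y (b d h\<^sub>2 \<Delta>)\<close> becomes
      \<open>- \<phi> (b h\<^sub>1 \<Delta>')\<close> by \<open>y_d\<close>, which cancels the
      surplus in \<open>\<phi> (b d v) = \<phi> b + \<phi> (b h\<^sub>1 \<Delta>')\<close>.\<close>
    fix b assume b: "b \<in> carrier A"
    have "h\<^sub>1 \<otimes>\<^bsub>A\<^esub> \<Delta>' \<otimes>\<^bsub>A\<^esub> (h\<^sub>1 \<otimes>\<^bsub>A\<^esub> c) = h\<^sub>1 \<otimes>\<^bsub>A\<^esub> (c \<otimes>\<^bsub>A\<^esub> \<Delta>) \<otimes>\<^bsub>A\<^esub> h\<^sub>2"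
      by (simp add: A.m_assoc Delta'_h1_c)
    then have "ract V (b \<otimes>\<^bsub>A\<^esub> (h\<^sub>1 \<otimes>\<^bsub>A\<^esub> \<Delta>' \<otimes>\<^bsub>A\<^esub> (h\<^sub>1 \<otimes>\<^bsub>A\<^esub> c))) x0 = \<ominus>\<^bsub>V\<^esub> \<phi> (b \<otimes>\<^bsub>A\<^esub> (h\<^sub>1 \<otimes>\<^bsub>A\<^esub> (c \<otimes>\<^bsub>A\<^esub> (\<Delta> \<otimes>\<^bsub>A\<^esub> v))))"
      using b \<phi>_v[of "b \<otimes>\<^bsub>A\<^esub> (h\<^sub>1 \<otimes>\<^bsub>A\<^esub> (c \<otimes>\<^bsub>A\<^esub> \<Delta>))"] by (simp add: A.m_assoc)
    then have "y (b \<otimes>\<^bsub>A\<^esub> (h\<^sub>1 \<otimes>\<^bsub>A\<^esub> \<Delta>') \<otimes>\<^bsub>A\<^esub> d) = \<ominus>\<^bsub>V\<^esub> \<phi> (b \<otimes>\<^bsub>A\<^esub> (h\<^sub>1 \<otimes>\<^bsub>A\<^esub> \<Delta>'))"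
      using b y_d[of "b \<otimes>\<^bsub>A\<^esub> (h\<^sub>1 \<otimes>\<^bsub>A\<^esub> \<Delta>')"]
      by (simp add: A.m_assoc c_Delta_v A.r_distr plus_homs_add[OF \<phi>] V.minus_add V.a_assoc V.l_neg)
    then have y_b: "y (b \<otimes>\<^bsub>A\<^esub> (d \<otimes>\<^bsub>A\<^esub> h\<^sub>2) \<otimes>\<^bsub>A\<^esub> \<Delta>) = \<ominus>\<^bsub>V\<^esub> \<phi> (b \<otimes>\<^bsub>A\<^esub> (h\<^sub>1 \<otimes>\<^bsub>A\<^esub> \<Delta>'))"
      using b by (simp add: A.m_assoc h1_Delta'_d)
    have "\<ominus>\<^bsub>V\<^esub> ract V (b \<otimes>\<^bsub>A\<^esub> (d \<otimes>\<^bsub>A\<^esub> h\<^sub>2)) x0 = \<phi> b \<oplus>\<^bsub>V\<^esub> \<phi> (b \<otimes>\<^bsub>A\<^esub> (h\<^sub>1 \<otimes>\<^bsub>A\<^esub> \<Delta>'))"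
      using b \<phi>_v[of "b \<otimes>\<^bsub>A\<^esub> d"] by (simp add: A.m_assoc d_v A.r_distr plus_homs_add[OF \<phi>])
    then show "snd (unit_point V x) b = snd z b"
      using b by (simp add: unit_point_def ract_x y_b a_minus_def V.minus_add V.a_assoc V.r_neg flip: \<phi>_def)
  qed
  moreover have "snd (unit_map V x) = snd w"
    by (rule G.plus_homs_eqI[OF unit_map_snd_closed[OF x] w'(2)])
      (simp add: unit_map_def snd_w shift_shift[symmetric] orbit_q)
  ultimately have "unit_map V x = w" by (simp add: prod_eq_iff unit_map_def z_def)
  then show "w \<in> unit_map V ` carrier V" using x by blast
qed (use unit_map_closed in auto)

lemma unit_map_iso:
  "restrict (unit_map V) (carrier V) \<in> lmod_iso (homotope K A \<Delta>) V
    (homotope_equivalence.glue K A \<Delta>' \<Delta> (\<ominus>\<^bsub>A\<^esub> u) (\<ominus>\<^bsub>A\<^esub> d) h\<^sub>2 h\<^sub>1 (glue V))"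
  using unit_map_hom unit_map_inj unit_map_surj
  by (simp add: lmod_iso_def bij_betw_def)

end


section \<open>The equivalence of categories\<close>

context homotope_equivalence
begin

text \<open>\<open>code\<close> brings the glued module into the universe \<open>'u\<close>; on
  morphisms \<open>glue_map\<close> is conjugated by it, and the restriction to the coded carrier
  keeps the result extensional.\<close>

definition glue_functor ::
  "('w \<times> ('a \<Rightarrow> 'w) \<Rightarrow> 'u) \<Rightarrow> (('k \<times> 'a, 'w) module, 'w \<Rightarrow> 'w, ('k \<times> 'a, 'u) module, 'u \<Rightarrow> 'u) fctr" where
  "glue_functor code = \<lparr>on_obj = (\<lambda>V. transport_module code (glue V)),
     on_hom = (\<lambda>X Y h. \<lambda>w\<in>code ` carrier (glue X). code (glue_map h (inv_into (carrier (glue X)) code w)))\<rparr>"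

lemma glue_functor_simps:
  "on_obj (glue_functor code) V = transport_module code (glue V)"
  "on_hom (glue_functor code) X Y h =
    (\<lambda>w\<in>code ` carrier (glue X). code (glue_map h (inv_into (carrier (glue X)) code w)))"
  by (simp_all add: glue_functor_def)

text \<open>A pair is coded by its element followed by the values of its function at the finitely
  many generators; all these lists have the same length. The code does not depend on
  \<open>V\<close>.\<close>

lemma glue_code:
  assumes "infinite (UNIV :: 'u set)"
  shows "\<exists>code :: 'u \<times> ('a \<Rightarrow> 'u) \<Rightarrow> 'u. \<forall>V :: ('k \<times> 'a, 'u) module.
    left_module (homotope K A \<Delta>) V \<longrightarrow> inj_on code (carrier (glue V))"
proof -
  obtain ys where ys: "\<forall>V :: ('k \<times> 'a, 'u) module. left_module (homotope K A \<Delta>) V \<longrightarrow>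
      inj_on (\<lambda>\<phi>. map \<phi> ys) (plus_homs \<Delta> V)"
    using homotope_plus_generators[OF surj closed(1)] ..
  obtain e :: "'u list \<Rightarrow> 'u" where e: "\<And>n. inj_on e {xs. length xs = n}"
    using infinite_encode_lists[OF assms] by blast
  have "inj_on (\<lambda>(x, \<phi>). e (x # map \<phi> ys)) (carrier (glue V))"
    if V: "left_module (homotope K A \<Delta>) V" for V :: "('k \<times> 'a, 'u) module"
  proof (rule inj_onI, clarify)
    interpret homotope_equivalence_module K A \<Delta> \<Delta>' c d u v h\<^sub>1 h\<^sub>2 V by (rule moduleI[OF V])
    fix x \<phi> y \<chi>
    assume x: "(x, \<phi>) \<in> carrier (glue V)" and y: "(y, \<chi>) \<in> carrier (glue V)"
      and "e (x # map \<phi> ys) = e (y # map \<chi> ys)"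
    then have "x # map \<phi> ys = y # map \<chi> ys"
      by (intro inj_onD[OF e[of "Suc (length ys)"]]) auto
    then show "x = y \<and> \<phi> = \<chi>"
      using inj_onD[OF ys[rule_format, OF V], of \<phi> \<chi>] glue_carrierD(2)[OF x] glue_carrierD(2)[OF y] by auto
  qed
  then show ?thesis by blast
qed

lemma glue_functor_on_hom:
  assumes "inj_on code (carrier (glue X))" "z \<in> carrier (glue X)"
  shows "on_hom (glue_functor code) X Y h (code z) = code (glue_map h z)"
  using assms by (simp add: glue_functor_simps)

text \<open>The coded map is the composite of decoding, \<open>glue_map h\<close> and coding, each a
  homomorphism.\<close>

lemma glue_functor_hom:
  assumes X: "left_module (homotope K A \<Delta>) X" and Y: "left_module (homotope K A \<Delta>) Y"
    and h: "h \<in> lmod_hom (homotope K A \<Delta>) X Y"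
    and codeX: "inj_on code (carrier (glue X))" and codeY: "inj_on code (carrier (glue Y))"
  shows "on_hom (glue_functor code) X Y h \<in>
    lmod_hom (homotope K A \<Delta>') (transport_module code (glue X)) (transport_module code (glue Y))"
proof -
  interpret X: homotope_equivalence_module K A \<Delta> \<Delta>' c d u v h\<^sub>1 h\<^sub>2 X by (rule moduleI[OF X])
  interpret Y: homotope_equivalence_module K A \<Delta> \<Delta>' c d u v h\<^sub>1 h\<^sub>2 Y by (rule moduleI[OF Y])
  let ?X = "transport_module code (glue X)" and ?Y = "transport_module code (glue Y)"
  let ?iX = "restrict code (carrier (glue X))" and ?iY = "restrict code (carrier (glue Y))"
  let ?jX = "restrict (inv_into (carrier (glue X)) ?iX) (carrier ?X)"
  note TX = transport_module[OF X.left_module_glue codeX] and TY = transport_module[OF Y.left_module_glue codeY]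
  have iY: "?iY \<in> lmod_hom (homotope K A \<Delta>') (glue Y) ?Y" using TY(2) by (simp add: lmod_iso_def)
  have jX: "?jX \<in> lmod_hom (homotope K A \<Delta>') ?X (glue X)"
    using lmod_iso_inv[OF TX(2) X.left_module_glue] by (simp add: lmod_iso_def)
  note H = glue_map_hom[OF X Y h]
  have "compose (carrier ?X) (compose (carrier (glue X)) ?iY (restrict (glue_map h) (carrier (glue X)))) ?jX
      \<in> lmod_hom (homotope K A \<Delta>') ?X ?Y"
    by (rule lmod_hom_comp[OF jX lmod_hom_comp[OF H iY X.left_module_glue] TX(1)])
  also have "compose (carrier ?X) (compose (carrier (glue X)) ?iY (restrict (glue_map h) (carrier (glue X)))) ?jX =
      on_hom (glue_functor code) X Y h"
  proof
    fix w
    show "compose (carrier ?X) (compose (carrier (glue X)) ?iY (restrict (glue_map h) (carrier (glue X)))) ?jX w =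
      on_hom (glue_functor code) X Y h w"
    proof (cases "w \<in> code ` carrier (glue X)")
      case True
      then obtain z where z: "z \<in> carrier (glue X)" "w = code z" by blast
      have "?jX w = z"
        using z inv_into_f_f[of ?iX "carrier (glue X)" z] codeX by (simp add: carrier_transport_module)
      then show ?thesis
        using z lmod_hom_closed[OF H z(1)]
        by (simp add: compose_def carrier_transport_module glue_functor_on_hom[OF codeX])
    qed (simp add: compose_def glue_functor_simps carrier_transport_module)
  qed
  finally show ?thesis .
qed

lemma is_functor_glue_functor:
  fixes code :: "'u \<times> ('a \<Rightarrow> 'u) \<Rightarrow> 'u"
  assumes code: "\<And>V :: ('k \<times> 'a, 'u) module. left_module (homotope K A \<Delta>) V \<Longrightarrow>
      inj_on code (carrier (glue V))"
  shows "is_functor (lmod_cat (homotope K A \<Delta>)) (lmod_cat (homotope K A \<Delta>')) (glue_functor code)"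
proof -
  have obj: "left_module (homotope K A \<Delta>') (on_obj (glue_functor code) X)"
    if "left_module (homotope K A \<Delta>) X" for X :: "('k \<times> 'a, 'u) module"
    using transport_module(1)[OF homotope_equivalence_module.left_module_glue[OF moduleI[OF that]] code[OF that]]
    by (simp add: glue_functor_simps)
  have hom: "on_hom (glue_functor code) X Y h \<in>
      lmod_hom (homotope K A \<Delta>') (on_obj (glue_functor code) X) (on_obj (glue_functor code) Y)"
    if "left_module (homotope K A \<Delta>) X" "left_module (homotope K A \<Delta>) Y" "h \<in> lmod_hom (homotope K A \<Delta>) X Y"
    for X Y :: "('k \<times> 'a, 'u) module" and h
    using glue_functor_hom[OF that code[OF that(1)] code[OF that(2)]] by (simp add: glue_functor_simps)
  have id: "on_hom (glue_functor code) X X (\<lambda>x\<in>carrier X. x) = (\<lambda>w\<in>carrier (on_obj (glue_functor code) X). w)"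
    if X: "left_module (homotope K A \<Delta>) X" for X :: "('k \<times> 'a, 'u) module"
    using code[OF X]
    by (auto simp: glue_functor_simps carrier_transport_module glue_map_id[OF X] intro!: restrict_ext)
  have comp: "on_hom (glue_functor code) X Z (compose (carrier X) g f) =
      compose (carrier (on_obj (glue_functor code) X)) (on_hom (glue_functor code) Y Z g) (on_hom (glue_functor code) X Y f)"
    if X: "left_module (homotope K A \<Delta>) X" and Y: "left_module (homotope K A \<Delta>) Y"
      and f: "f \<in> lmod_hom (homotope K A \<Delta>) X Y" for X Y Z :: "('k \<times> 'a, 'u) module" and f g
  proof
    fix w
    show "on_hom (glue_functor code) X Z (compose (carrier X) g f) w =
      compose (carrier (on_obj (glue_functor code) X)) (on_hom (glue_functor code) Y Z g) (on_hom (glue_functor code) X Y f) w"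
    proof (cases "w \<in> code ` carrier (glue X)")
      case True
      then obtain z where z: "z \<in> carrier (glue X)" "w = code z" by blast
      have "glue_map f z \<in> carrier (glue Y)"
        using lmod_hom_closed[OF glue_map_hom[OF X Y f] z(1)] z by simp
      moreover have "glue_map (compose (carrier X) g f) z = glue_map g (glue_map f z)"
        unfolding glue_map_comp by (rule glue_map_cong[OF X z(1)]) (simp add: compose_def)
      ultimately show ?thesis
        using z by (simp add: compose_def glue_functor_simps(1) carrier_transport_module
          glue_functor_on_hom[OF code[OF X]] glue_functor_on_hom[OF code[OF Y]])
    qed (simp add: compose_def glue_functor_simps carrier_transport_module)
  qed
  show ?thesis
    unfolding is_functor_def by (auto simp: lmod_cat_def obj hom id comp)
qed

text \<open>This is naturality of the comparison map: its formula involves only module operations,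
  which \<open>h\<close> preserves.\<close>

lemma glue_map_unit_map:
  assumes X: "left_module (homotope K A \<Delta>) X" and Y: "left_module (homotope K A \<Delta>) Y"
    and h: "h \<in> lmod_hom (homotope K A \<Delta>) X Y" and x: "x \<in> carrier X"
  shows "glue_map (glue_map h) (unit_map X x) = unit_map Y (h x)"
proof -
  interpret X: homotope_equivalence_module K A \<Delta> \<Delta>' c d u v h\<^sub>1 h\<^sub>2 X by (rule moduleI[OF X])
  interpret Y: homotope_equivalence_module K A \<Delta> \<Delta>' c d u v h\<^sub>1 h\<^sub>2 Y by (rule moduleI[OF Y])
  note hh = lmod_hom_closed[OF h] lmod_hom_add[OF h] lmod_hom_sact[OF h] lmod_hom_ract[OF h]
  have hm: "\<And>x. x \<in> carrier X \<Longrightarrow> h (\<ominus>\<^bsub>X\<^esub> x) = \<ominus>\<^bsub>Y\<^esub> h x"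
    by (rule additive_minus[OF X.V.abelian_group_axioms Y.V.abelian_group_axioms]; simp add: hh)
  have 1: "glue_map h (unit_point X x) = unit_point Y (h x)"
    using x by (auto simp: glue_map_def unit_point_def hh hm intro!: restrict_ext)
  have 2: "glue_map h (inn X (shift (a \<otimes>\<^bsub>A\<^esub> q) (orbit X x))) = inn Y (shift (a \<otimes>\<^bsub>A\<^esub> q) (orbit Y (h x)))"
    if "a \<in> carrier A" for a
    using x that by (auto simp: glue_map_def inn_def shift_def orbit_def hh hm intro!: restrict_ext)
  show ?thesis
    by (auto simp: glue_map_def[of "glue_map h"] unit_map_def 1 2 intro!: restrict_ext)
qed

interpretation S: homotope_equivalence K A \<Delta>' \<Delta> "\<ominus>\<^bsub>A\<^esub> u" "\<ominus>\<^bsub>A\<^esub> v" "\<ominus>\<^bsub>A\<^esub> c" "\<ominus>\<^bsub>A\<^esub> d" h\<^sub>2 h\<^sub>1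
  by (rule swapped)

lemma glue_functor_round_trip:
  fixes code code' :: "'u \<times> ('a \<Rightarrow> 'u) \<Rightarrow> 'u"
  assumes code: "\<And>V :: ('k \<times> 'a, 'u) module. left_module (homotope K A \<Delta>) V \<Longrightarrow>
      inj_on code (carrier (glue V))"
    and code': "\<And>V :: ('k \<times> 'a, 'u) module. left_module (homotope K A \<Delta>') V \<Longrightarrow>
      inj_on code' (carrier (S.glue V))"
  shows "naturally_isomorphic (lmod_cat (homotope K A \<Delta>)) (lmod_cat (homotope K A \<Delta>))
    (comp_functor (S.glue_functor code') (glue_functor code)) id_functor"
proof -
  define T where "T X = transport_module code (glue X)" for X :: "('k \<times> 'a, 'u) module"
  define \<iota> where "\<iota> X = restrict code (carrier (glue X))" for X :: "('k \<times> 'a, 'u) module"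
  \<comment> \<open>The comparison runs from \<open>X\<close> to the double construction, then
    recodes the inner \<open>glue\<close>, then the outer one.\<close>
  define \<theta> where "\<theta> X = compose (carrier X) (restrict code' (carrier (S.glue (T X))))
    (compose (carrier X) (restrict (glue_map (\<iota> X)) (carrier (S.glue (glue X)))) (restrict (unit_map X) (carrier X)))"
    for X :: "('k \<times> 'a, 'u) module"
  have glue: "left_module (homotope K A \<Delta>') (glue X)"
    and unit: "restrict (unit_map X) (carrier X) \<in> lmod_iso (homotope K A \<Delta>) X (S.glue (glue X))"
    and T: "left_module (homotope K A \<Delta>') (T X)" "\<iota> X \<in> lmod_iso (homotope K A \<Delta>') (glue X) (T X)"
    if X: "left_module (homotope K A \<Delta>) X" for X :: "('k \<times> 'a, 'u) module"
  proof -
    interpret X: homotope_equivalence_module K A \<Delta> \<Delta>' c d u v h\<^sub>1 h\<^sub>2 X by (rule moduleI[OF X])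
    show "left_module (homotope K A \<Delta>') (glue X)" by (rule X.left_module_glue)
    show "restrict (unit_map X) (carrier X) \<in> lmod_iso (homotope K A \<Delta>) X (S.glue (glue X))"
      by (rule X.unit_map_iso)
    show "left_module (homotope K A \<Delta>') (T X)" "\<iota> X \<in> lmod_iso (homotope K A \<Delta>') (glue X) (T X)"
      unfolding T_def \<iota>_def using transport_module[OF X.left_module_glue code[OF X]] by auto
  qed
  have SglueT: "left_module (homotope K A \<Delta>) (S.glue (T X))" if "left_module (homotope K A \<Delta>) X" for X :: "('k \<times> 'a, 'u) module"
    using homotope_equivalence_module.left_module_glue[OF S.moduleI[OF T(1)[OF that]]] .
  have unit_closed: "unit_map X x \<in> carrier (S.glue (glue X))"
    if "left_module (homotope K A \<Delta>) X" "x \<in> carrier X" for X :: "('k \<times> 'a, 'u) module" and x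
    using lmod_hom_closed[of "restrict (unit_map X) (carrier X)"] unit[OF that(1)] that(2)
    by (fastforce simp: lmod_iso_def)
  have map_closed: "glue_map (\<iota> X) w \<in> carrier (S.glue (T X))"
    if "left_module (homotope K A \<Delta>) X" "w \<in> carrier (S.glue (glue X))" for X :: "('k \<times> 'a, 'u) module" and w
    using lmod_hom_closed[of "restrict (glue_map (\<iota> X)) (carrier (S.glue (glue X)))"]
      S.glue_map_iso[OF glue T, of X] that by (fastforce simp: lmod_iso_def)
  have \<theta>_eq: "\<theta> X x = code' (glue_map (\<iota> X) (unit_map X x))"
    if "left_module (homotope K A \<Delta>) X" "x \<in> carrier X" for X :: "('k \<times> 'a, 'u) module" and x
    using that unit_closed[OF that] map_closed[OF that(1) unit_closed[OF that]] by (simp add: \<theta>_def compose_def)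
  show ?thesis
  proof (rule naturally_isomorphic_id_lmod_catI)
    fix X assume X: "left_module (homotope K A \<Delta>) (X :: ('k \<times> 'a, 'u) module)"
    have "\<theta> X \<in> lmod_iso (homotope K A \<Delta>) X (transport_module code' (S.glue (T X)))"
      unfolding \<theta>_def
      by (rule lmod_iso_comp[OF lmod_iso_comp[OF unit[OF X] S.glue_map_iso[OF glue[OF X] T[OF X]] X]
            transport_module(2)[OF SglueT[OF X] code'[OF T(1)[OF X]]] X])
    then show "\<theta> X \<in> lmod_iso (homotope K A \<Delta>) X (on_obj (comp_functor (S.glue_functor code') (glue_functor code)) X)"
      by (simp add: comp_functor_def glue_functor_simps S.glue_functor_simps T_def)
  next
    fix X Y h and x
    assume X: "left_module (homotope K A \<Delta>) (X :: ('k \<times> 'a, 'u) module)"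
      and Y: "left_module (homotope K A \<Delta>) (Y :: ('k \<times> 'a, 'u) module)"
      and h: "h \<in> lmod_hom (homotope K A \<Delta>) X Y" and x: "x \<in> carrier X"
    have "on_hom (comp_functor (S.glue_functor code') (glue_functor code)) X Y h (\<theta> X x) =
        code' (glue_map (on_hom (glue_functor code) X Y h) (glue_map (\<iota> X) (unit_map X x)))"
      unfolding \<theta>_eq[OF X x]
      using S.glue_functor_on_hom[OF code'[OF T(1)[OF X]] map_closed[OF X unit_closed[OF X x]]]
      by (simp add: comp_functor_def glue_functor_simps(1) T_def)
    \<comment> \<open>The inner code cancels on elements \<open>\<iota> X z\<close>, so the two
      composites need only be compared on \<open>glue X\<close>.\<close>
    also have "glue_map (on_hom (glue_functor code) X Y h) (glue_map (\<iota> X) (unit_map X x)) =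
        glue_map (\<iota> Y) (glue_map (glue_map h) (unit_map X x))"
      unfolding glue_map_comp
    proof (rule S.glue_map_cong[OF glue[OF X] unit_closed[OF X x]])
      fix z assume z: "z \<in> carrier (glue X)"
      have "glue_map h z \<in> carrier (glue Y)"
        using lmod_hom_closed[OF glue_map_hom[OF X Y h] z] z by simp
      then show "on_hom (glue_functor code) X Y h (\<iota> X z) = \<iota> Y (glue_map h z)"
        using z by (simp add: \<iota>_def glue_functor_on_hom[OF code[OF X]])
    qed
    also have "glue_map (glue_map h) (unit_map X x) = unit_map Y (h x)"
      by (rule glue_map_unit_map[OF X Y h x])
    also have "code' (glue_map (\<iota> Y) (unit_map Y (h x))) = \<theta> Y (h x)"
      using \<theta>_eq[OF Y lmod_hom_closed[OF h x]] by simp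
    finally show "\<theta> Y (h x) = on_hom (comp_functor (S.glue_functor code') (glue_functor code)) X Y h (\<theta> X x)" ..
  qed
qed

end

theorem theorem60:
  fixes K :: "'k ring" and A :: "('k, 'a) module"
    and \<Delta> \<Delta>' c d u v h\<^sub>1 h\<^sub>2 :: 'a
  assumes universe: "infinite (UNIV :: 'u set)"
    and "unital_algebra K A" and "free_module K A"
    and "well_tempered K A \<Delta>" and "well_tempered K A \<Delta>'"
    and "c \<in> carrier A" "d \<in> carrier A" "u \<in> carrier A" "v \<in> carrier A"
      "h\<^sub>1 \<in> carrier A" "h\<^sub>2 \<in> carrier A"
    and "c \<otimes>\<^bsub>A\<^esub> \<Delta> = \<Delta>' \<otimes>\<^bsub>A\<^esub> d" and "u \<otimes>\<^bsub>A\<^esub> \<Delta>' = \<Delta> \<otimes>\<^bsub>A\<^esub> v"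
    and "c \<otimes>\<^bsub>A\<^esub> u = \<one>\<^bsub>A\<^esub> \<oplus>\<^bsub>A\<^esub> \<Delta>' \<otimes>\<^bsub>A\<^esub> h\<^sub>1"
    and "d \<otimes>\<^bsub>A\<^esub> v = \<one>\<^bsub>A\<^esub> \<oplus>\<^bsub>A\<^esub> h\<^sub>1 \<otimes>\<^bsub>A\<^esub> \<Delta>'"
    and "u \<otimes>\<^bsub>A\<^esub> c = \<one>\<^bsub>A\<^esub> \<oplus>\<^bsub>A\<^esub> \<Delta> \<otimes>\<^bsub>A\<^esub> h\<^sub>2"
    and "v \<otimes>\<^bsub>A\<^esub> d = \<one>\<^bsub>A\<^esub> \<oplus>\<^bsub>A\<^esub> h\<^sub>2 \<otimes>\<^bsub>A\<^esub> \<Delta>"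
  shows "equivalent_categories
    (lmod_cat (homotope K A \<Delta>) :: (('k \<times> 'a, 'u) module, 'u \<Rightarrow> 'u) cat)
    (lmod_cat (homotope K A \<Delta>') :: (('k \<times> 'a, 'u) module, 'u \<Rightarrow> 'u) cat)"
proof -
  have E: "homotope_equivalence K A \<Delta> \<Delta>' c d u v h\<^sub>1 h\<^sub>2"
    using assms(2-) by (simp add: homotope_equivalence_def homotope_equivalence_axioms_def well_tempered_def)
  interpret E: homotope_equivalence K A \<Delta> \<Delta>' c d u v h\<^sub>1 h\<^sub>2 by (rule E)
  interpret S: homotope_equivalence K A \<Delta>' \<Delta> "\<ominus>\<^bsub>A\<^esub> u" "\<ominus>\<^bsub>A\<^esub> v" "\<ominus>\<^bsub>A\<^esub> c" "\<ominus>\<^bsub>A\<^esub> d" h\<^sub>2 h\<^sub>1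
    by (rule E.swapped)
  obtain code :: "'u \<times> ('a \<Rightarrow> 'u) \<Rightarrow> 'u"
    where code: "\<And>V :: ('k \<times> 'a, 'u) module. left_module (homotope K A \<Delta>) V \<Longrightarrow> inj_on code (carrier (E.glue V))"
    using E.glue_code[OF universe] by blast
  obtain code' :: "'u \<times> ('a \<Rightarrow> 'u) \<Rightarrow> 'u"
    where code': "\<And>V :: ('k \<times> 'a, 'u) module. left_module (homotope K A \<Delta>') V \<Longrightarrow> inj_on code' (carrier (S.glue V))"
    using S.glue_code[OF universe] by blast
  \<comment> \<open>Swapping twice turns \<open>c\<close> into \<open>- (- c)\<close>, and likewise
    \<open>d\<close>, \<open>u\<close> and \<open>v\<close>; simplification removes the double
    signs, so the second round trip is the first one for the swapped data.\<close>
  have "naturally_isomorphic (lmod_cat (homotope K A \<Delta>')) (lmod_cat (homotope K A \<Delta>'))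
      (comp_functor (E.glue_functor code) (S.glue_functor code')) id_functor"
    using S.glue_functor_round_trip[OF code', of code] code by simp
  then show ?thesis
    unfolding equivalent_categories_def
    using E.is_functor_glue_functor[OF code] S.is_functor_glue_functor[OF code']
      E.glue_functor_round_trip[OF code code'] by blast
qed

end
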